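(* Let the local costs be quadratic, $J_i(x_i,\{x_j\}_{j\in\mathcal{N}_i})=\frac12\big(y_i-\sum_{j\in\mathcal{N}_i^+}A_{ij}x_j\big)^{\top}W_i\big(y_i-\sum_{j\in\mathcal{N}_i^+}A_{ij}x_j\big)$ with $W_i>0$, and assume that $J(x)=\sum_{i=1}^N J_i(x_i,\{x_j\}_{j\in\mathcal{N}_i})$ is strictly convex and radially unbounded on $\mathbb{R}^n$, with unique minimizer $x^*$. Assume that the communication is persistent: there exists a constant $T$ such that, for all $t\ge 0$, all $i\in\mathcal{V}$ and all $j\in\mathcal{N}_i$, $$\mathbb{P}\left[\{\gamma^{(i)}_j(t),\dots,\gamma^{(i)}_j(t+T)\}=\{0,\dots,0\}\right]=0 .$$ Then there exists $\bar\epsilon>0$ such that, if $0<\epsilon<\bar\epsilon$, then for any $x(0)\in\mathbb{R}^n$ (with probability one) the trajectory $x(t)$ generated by the resilient weighted least squares (RWLS) algorithm with step size $\epsilon$ converges exponentially fast to $x^*$, i.e. $$\|x(t)-x^*\|\le C\rho^t\quad\text{for all } t\ge 0$$ for some constants $C>0$ and $0<\rho<1$.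
   Context: Setting. $\mathcal{G}=(\mathcal{V},\mathcal{E})$ is a strongly connected bidirected graph ($(i,j)\in\mathcal{E}$ implies $(j,i)\in\mathcal{E}$) with nodes (agents) $\mathcal{V}=\{1,\dots,N\}$. $\mathcal{N}_i=\{j\in\mathcal{V}:(i,j)\in\mathcal{E}\}$ is the set of neighbors of $i$, and $\mathcal{N}_i^+=\mathcal{N}_i\cup\{i\}$. Agent $i$ has a state $x_i\in\mathbb{R}^{n_i}$; $x=(x_1,\dots,x_N)\in\mathbb{R}^n$, $n=\sum_i n_i$. In the costs, $y_i\in\mathbb{R}^{m_i}$ are given vectors, $A_{ij}\in\mathbb{R}^{m_i\times n_j}$ are given matrices, and $W_i\in\mathbb{R}^{m_i\times m_i}$ are symmetric positive definite weights. The problem is $\min_x J(x)$. Radially unbounded means $J(x)\to\infty$ as $\|x\|\to\infty$. Packet losses: for $t\ge0$ and $j\in\mathcal{N}_i$, $\gamma^{(i)}_j(t)\in\{0,1\}$ is the (random) indicator that agent $i$ receives the packet sent by agent $j$ at iteration $t$; $\gamma_i^{(i)}(t)=1$ always. RWLS algorithm with step size $\epsilon>0$. Each agent $i$ stores, besides $x_i$, auxiliary variables $\widehat{x}^{(i)}_j\in\mathbb{R}^{n_j}$, $\widehat\rho^{(i)}_j\in\mathbb{R}^{n_i}$, $\widehat\xi^{(i)}_j\in\mathbb{R}^{n_i\times n_i}$ for $j\in\mathcal{N}_i$. Initialization: $x_i(0)$ is given, and $\widehat{x}^{(i)}_j(-1)=0$, $\widehat\rho^{(i)}_j(-1)=0$,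 $\widehat\xi^{(i)}_j(-1)=I$ for $j\in\mathcal{N}_i$. At each iteration $t=0,1,2,\dots$: 1. (Transmission) Each agent $i$ computes, for all $j\in\mathcal{N}_i$, $$\rho^{(j)}_i(t)=A_{ij}^{\top}W_i\Big(A_{ii}x_i(t)+\sum_{k\in\mathcal{N}_i}A_{ik}\widehat{x}^{(i)}_k(t-1)-y_i\Big),\qquad \xi^{(j)}_i(t)=A_{ij}^{\top}W_iA_{ij},$$ and broadcasts $x_i(t)$ and $\{\rho^{(j)}_i(t),\xi^{(j)}_i(t)\}_{j\in\mathcal{N}_i}$ in a single packet. 2. (Reception) For each $j\in\mathcal{N}_i$: if $\gamma^{(i)}_j(t)=1$, then $(\widehat{x}^{(i)}_j(t),\widehat\rho^{(i)}_j(t),\widehat\xi^{(i)}_j(t))=(x_j(t),\rho^{(i)}_j(t),\xi^{(i)}_j(t))$; if $\gamma^{(i)}_j(t)=0$, then $(\widehat{x}^{(i)}_j(t),\widehat\rho^{(i)}_j(t),\widehat\xi^{(i)}_j(t))=(\widehat{x}^{(i)}_j(t-1),\widehat\rho^{(i)}_j(t-1),\widehat\xi^{(i)}_j(t-1))$. 3. (Update) Each agent $i$ sets $\widehat\rho^{(i)}_i(t)=A_{ii}^{\top}W_i\big(A_{ii}x_i(t)+\sum_{k\in\mathcal{N}_i}A_{ik}\widehat{x}^{(i)}_k(t)-y_i\big)$, $\widehat\xi^{(i)}_i(t)=A_{ii}^{\top}W_iA_{ii}$ and $$x_i(t+1)=x_i(t)-\epsilon\Big(\sum_{j\in\mathcal{N}_i^+}\widehat\xi^{(i)}_j(t)\Big)^{-1}\Big(\sum_{j\in\mathcal{N}_i^+}\widehat\rho^{(i)}_j(t)\Big).$$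 *)

theory Defs
  imports
    "HOL-Probability.Probability"
    "Jordan_Normal_Form.Gauss_Jordan_Elimination"
    "Graph_Theory.Graph_Theory"
begin

text \<open>The inner product of Euclidean spaces is hidden in favour of the scalar product
  of vectors of variable dimension.\<close>

no_notation inner (infixl \<open>\<bullet>\<close> 70)

type_synonym state = "nat \<Rightarrow> real Matrix.vec"

text \<open>A point \<open>x = (x_1, ..., x_N)\<close> of the product of the spaces of dimensions \<open>n 1, ..., n N\<close>
  is an extensional family of vectors, so that equality of points is equality of functions.\<close>

definition state_space :: "nat \<Rightarrow> (nat \<Rightarrow> nat) \<Rightarrow> state set" where
  "state_space N n = (\<Pi>\<^sub>E i\<in>{1..N}. carrier_vec (n i))"

definition state_norm :: "nat \<Rightarrow> state \<Rightarrow> real" where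
  "state_norm N x = sqrt (\<Sum>i\<in>{1..N}. x i \<bullet> x i)"

definition strictly_convex :: "nat \<Rightarrow> (nat \<Rightarrow> nat) \<Rightarrow> (state \<Rightarrow> real) \<Rightarrow> bool" where
  "strictly_convex N n f \<longleftrightarrow>
     (\<forall>x\<in>state_space N n. \<forall>z\<in>state_space N n. \<forall>u. x \<noteq> z \<and> 0 < u \<and> u < 1 \<longrightarrow>
        f (\<lambda>i\<in>{1..N}. u \<cdot>\<^sub>v x i + (1 - u) \<cdot>\<^sub>v z i) < u * f x + (1 - u) * f z)"

definition radially_unbounded :: "nat \<Rightarrow> (nat \<Rightarrow> nat) \<Rightarrow> (state \<Rightarrow> real) \<Rightarrow> bool" where
  "radially_unbounded N n f \<longleftrightarrow>
     (\<forall>b. \<exists>r. \<forall>x\<in>state_space N n. r < state_norm N x \<longrightarrow> b < f x)"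

definition unique_minimizer :: "nat \<Rightarrow> (nat \<Rightarrow> nat) \<Rightarrow> (state \<Rightarrow> real) \<Rightarrow> state \<Rightarrow> bool" where
  "unique_minimizer N n f xs \<longleftrightarrow>
     xs \<in> state_space N n \<and> (\<forall>x\<in>state_space N n. x \<noteq> xs \<longrightarrow> f xs < f x)"

definition pos_def_mat :: "nat \<Rightarrow> real mat \<Rightarrow> bool" where
  "pos_def_mat d B \<longleftrightarrow> B \<in> carrier_mat d d \<and> transpose_mat B = B \<and>
     (\<forall>v\<in>carrier_vec d. v \<noteq> 0\<^sub>v d \<longrightarrow> 0 < v \<bullet> (B *\<^sub>v v))"

definition neighbors :: "nat pair_pre_digraph \<Rightarrow> nat \<Rightarrow> nat set" where
  "neighbors G i = {j. (i, j) \<in> parcs G}"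

definition closed_neighbors :: "nat pair_pre_digraph \<Rightarrow> nat \<Rightarrow> nat set" where
  "closed_neighbors G i = neighbors G i \<union> {i}"

text \<open>The memory of the agents at the beginning of iteration \<open>t\<close>: \<open>cur i\<close> is \<open>x_i(t)\<close>, whereas the stored values
  \<open>x_hat i j\<close>, \<open>rho_hat i j\<close>, \<open>xi_hat i j\<close> are those that agent \<open>i\<close> holds for its neighbor \<open>j\<close>
  before the reception at step \<open>t\<close>, that is with time stamp \<open>t - 1\<close>. The entries for \<open>j\<close>
  not adjacent to \<open>i\<close> are never used.\<close>

record rwls_memory =
  cur :: state
  x_hat :: "nat \<Rightarrow> nat \<Rightarrow> real Matrix.vec"
  rho_hat :: "nat \<Rightarrow> nat \<Rightarrow> real Matrix.vec"
  xi_hat :: "nat \<Rightarrow> nat \<Rightarrow> real mat"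

text \<open>\<open>pair_graph\<close> states that the graph is finite, symmetric and has no loops.\<close>

locale wls_problem =
  fixes N :: nat
    and G :: "nat pair_pre_digraph"
    and n m :: "nat \<Rightarrow> nat"
    and A :: "nat \<Rightarrow> nat \<Rightarrow> real mat"
    and W :: "nat \<Rightarrow> real mat"
    and y :: "nat \<Rightarrow> real Matrix.vec"
  assumes graph: "pair_graph G"
    and nodes: "pverts G = {1..N}"
    and strongly_conn: "strongly_connected (with_proj G)"
    and y_dim: "i \<in> {1..N} \<Longrightarrow> y i \<in> carrier_vec (m i)"
    and A_dim: "i \<in> {1..N} \<Longrightarrow> j \<in> closed_neighbors G i \<Longrightarrow> A i j \<in> carrier_mat (m i) (n j)"
    and W_pos_def: "i \<in> {1..N} \<Longrightarrow> pos_def_mat (m i) (W i)"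
begin

definition local_cost :: "nat \<Rightarrow> state \<Rightarrow> real" where
  "local_cost i x =
     (let r = y i - finsum_vec TYPE(real) (m i) (\<lambda>j. A i j *\<^sub>v x j) (closed_neighbors G i)
      in 1 / 2 * (r \<bullet> (W i *\<^sub>v r)))"

definition J :: "state \<Rightarrow> real" where
  "J x = (\<Sum>i\<in>{1..N}. local_cost i x)"

text \<open>\<open>rho i j x xh\<close> is the vector that agent \<open>i\<close> computes for \<open>j\<close> (superscript \<open>j\<close>, subscript \<open>i\<close>
  in the usual notation) from the states \<open>x\<close> and the values \<open>xh\<close> stored for the neighbors;
  likewise for \<open>xi i j\<close>.\<close>

definition rho :: "nat \<Rightarrow> nat \<Rightarrow> state \<Rightarrow> (nat \<Rightarrow> nat \<Rightarrow> real Matrix.vec) \<Rightarrow> real Matrix.vec" where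
  "rho i j x xh = (transpose_mat (A i j) * W i) *\<^sub>v
     (A i i *\<^sub>v x i + finsum_vec TYPE(real) (m i) (\<lambda>k. A i k *\<^sub>v xh i k) (neighbors G i) - y i)"

definition xi :: "nat \<Rightarrow> nat \<Rightarrow> real mat" where
  "xi i j = transpose_mat (A i j) * W i * A i j"

definition rwls_init :: "state \<Rightarrow> rwls_memory" where
  "rwls_init x0 = \<lparr> cur = x0, x_hat = (\<lambda>i j. 0\<^sub>v (n j)), rho_hat = (\<lambda>i j. 0\<^sub>v (n i)),
     xi_hat = (\<lambda>i j. 1\<^sub>m (n i)) \<rparr>"

text \<open>Here \<open>g i j = 1\<close> means that \<open>i\<close> receives the packet of \<open>j\<close>. The values sent by \<open>j\<close> to \<open>i\<close>
  are computed from the memory before the reception, those of \<open>i\<close> for itself (the diagonal of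
  \<open>rh\<close> and \<open>xih\<close>) from the estimates \<open>xh\<close> after the reception.\<close>

definition rwls_step :: "real \<Rightarrow> (nat \<Rightarrow> nat \<Rightarrow> nat) \<Rightarrow> rwls_memory \<Rightarrow> rwls_memory" where
  "rwls_step \<epsilon> g s =
     (let x = cur s;
          xh = (\<lambda>i j. if g i j = 1 then x j else x_hat s i j);
          rh = (\<lambda>i j. if j = i then rho i i x xh
                      else if g i j = 1 then rho j i x (x_hat s) else rho_hat s i j);
          xih = (\<lambda>i j. if j = i then xi i i
                       else if g i j = 1 then xi j i else xi_hat s i j)
      in \<lparr> cur = (\<lambda>i. x i - \<epsilon> \<cdot>\<^sub>v
             (the (mat_inverse (finsum (ring_mat TYPE(real) (n i) ()) (xih i) (closed_neighbors G i)))
               *\<^sub>v finsum_vec TYPE(real) (n i) (rh i) (closed_neighbors G i))),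
           x_hat = xh, rho_hat = rh, xi_hat = xih \<rparr>)"

primrec rwls :: "real \<Rightarrow> (nat \<Rightarrow> nat \<Rightarrow> nat \<Rightarrow> nat) \<Rightarrow> state \<Rightarrow> nat \<Rightarrow> rwls_memory" where
  "rwls \<epsilon> g x0 0 = rwls_init x0"
| "rwls \<epsilon> g x0 (Suc t) = rwls_step \<epsilon> (\<lambda>i j. g i j t) (rwls \<epsilon> g x0 t)"

definition trajectory :: "real \<Rightarrow> (nat \<Rightarrow> nat \<Rightarrow> nat \<Rightarrow> nat) \<Rightarrow> state \<Rightarrow> nat \<Rightarrow> state" where
  "trajectory \<epsilon> g x0 t = cur (rwls \<epsilon> g x0 t)"

end

end

theory Submission
  imports Defs "Jordan_Normal_Form.Determinant"
begin

text \<open>Write \<open>e(t) = x(t) - x*\<close> for the error. Since \<open>x*\<close> minimizes the quadratic function \<open>J\<close>, the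
gradient of \<open>J\<close> at \<open>x* + e\<close> is \<open>H e\<close> with \<open>H\<close> the Hessian of \<open>J\<close>, and radial unboundedness of
\<open>J\<close> bounds the form \<open>e . H e\<close> below by a multiple of \<open>|e|^2\<close> (\<open>hess_form_coercive\<close>). If all
agents always had current values, the algorithm would be the damped block Jacobi iteration
\<open>e(t+1) = e(t) - \<epsilon> D^-1 H e(t)\<close>, where \<open>D\<close> is the block diagonal of \<open>H\<close>; for small \<open>\<epsilon>\<close> it
contracts the energy \<open>e . D e\<close> by a factor \<open>1 - a \<epsilon>\<close> per step, with a constant \<open>a > 0\<close>.

Transmission and packet losses only make the information old. Once the start-up phase is over,
each stored value dates from at most \<open>T\<close> steps ago, and it was computed by its sender from
values that were themselves at most \<open>T + 1\<close> steps old. Hence, from time \<open>2 T + 1\<close> on, agent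
\<open>i\<close> uses the exact block \<open>D_i\<close> and a gradient in which each error block \<open>e_k(t)\<close> is replaced
by some \<open>e_k(s)\<close> with \<open>t - (2 T + 1) \<le> s \<le> t\<close> (\<open>delayed_update\<close>, \<open>error_recursion\<close>).

The delay costs only a second order term. A step has length \<open>O(\<epsilon>)\<close> times the recent errors, so
the delayed errors differ from the current ones by \<open>O(\<epsilon>)\<close> times the largest error in a window
of bounded length, and this difference enters the energy balance with another factor \<open>\<epsilon>\<close>. With
\<open>B\<close> the largest energy in the window, \<open>energy (e(t+1)) \<le> (1 - 2 a \<epsilon>) energy (e(t)) + O(\<epsilon>^2)
B\<close>, which is at most \<open>(1 - a \<epsilon>) B\<close> when \<open>\<epsilon>\<close> is small (\<open>delayed_descent_contraction\<close>). A
sequence that is bounded by a fixed fraction of its maximum over the last \<open>L\<close> steps decays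
exponentially (\<open>delayed_contraction_decay\<close>).

All thresholds depend on the problem data and on \<open>T\<close> only, so the bound on \<open>\<epsilon>\<close> is uniform in
the initial state and in the realization of the losses. Randomness enters only through the
countably many null events "no packet during a window", which are discarded together.\<close>

section \<open>Euclidean norms and finite sums of vectors\<close>

no_notation inner (infix \<open>\<bullet>\<close> 70)

definition vnorm :: "real Matrix.vec \<Rightarrow> real" where
  "vnorm v = sqrt (v \<bullet> v)"

text \<open>This form inherits the triangle and Cauchy-Schwarz inequalities from sums of squares over a
  finite index set.\<close>

lemma vnorm_eq_L2_set: "vnorm v = L2_set (vec_index v) {0..<dim_vec v}"
  by (simp add: vnorm_def L2_set_def scalar_prod_def power2_eq_square)

lemma vnorm_nonneg [simp]: "0 \<le> vnorm v"
  by (simp add: vnorm_eq_L2_set)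

lemma scalar_prod_self_nonneg: "0 \<le> v \<bullet> v" for v :: "real Matrix.vec"
  by (simp add: scalar_prod_def sum_nonneg)

lemma vnorm_square: "(vnorm v)\<^sup>2 = v \<bullet> v"
  by (simp add: vnorm_def scalar_prod_self_nonneg)

lemma scalar_prod_self_pos:
  fixes v :: "real Matrix.vec"
  assumes "v \<in> carrier_vec d" "v \<noteq> 0\<^sub>v d"
  shows "0 < v \<bullet> v"
proof -
  obtain a where a: "a < d" "vec_index v a \<noteq> 0"
    using assms by (metis carrier_vecD eq_vecI index_zero_vec(1,2))
  have "0 < (\<Sum>i = 0..<d. vec_index v i * vec_index v i)"
    by (rule sum_pos2[of _ a]) (use a in \<open>auto simp: not_less\<close>, metis not_real_square_gt_zero)
  thus ?thesis using assms by (simp add: scalar_prod_def)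
qed

lemma abs_scalar_prod_le:
  assumes "v \<in> carrier_vec d" "w \<in> carrier_vec d"
  shows "\<bar>v \<bullet> w\<bar> \<le> vnorm v * vnorm w"
proof -
  have "\<bar>v \<bullet> w\<bar> \<le> (\<Sum>a\<in>{0..<d}. \<bar>vec_index v a\<bar> * \<bar>vec_index w a\<bar>)"
    using assms unfolding scalar_prod_def by (simp flip: abs_mult)
  also have "\<dots> \<le> L2_set (vec_index v) {0..<d} * L2_set (vec_index w) {0..<d}"
    by (rule L2_set_mult_ineq)
  finally show ?thesis using assms by (simp add: vnorm_eq_L2_set)
qed

lemma vnorm_add_le:
  assumes "v \<in> carrier_vec d" "w \<in> carrier_vec d"
  shows "vnorm (v + w) \<le> vnorm v + vnorm w"
proof -
  have "vnorm (v + w) = L2_set (\<lambda>a. vec_index v a + vec_index w a) {0..<d}"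
    using assms by (simp add: vnorm_eq_L2_set L2_set_def)
  also have "\<dots> \<le> L2_set (vec_index v) {0..<d} + L2_set (vec_index w) {0..<d}"
    by (rule L2_set_triangle_ineq)
  finally show ?thesis using assms by (simp add: vnorm_eq_L2_set)
qed

lemma vnorm_smult: "vnorm (r \<cdot>\<^sub>v v) = \<bar>r\<bar> * vnorm v"
proof -
  have "vnorm (r \<cdot>\<^sub>v v) = L2_set (\<lambda>a. \<bar>r\<bar> * vec_index v a) {0..<dim_vec v}"
    by (simp add: vnorm_eq_L2_set L2_set_def power_mult_distrib)
  thus ?thesis by (simp add: L2_set_right_distrib vnorm_eq_L2_set)
qed

lemma vnorm_zero [simp]: "vnorm (0\<^sub>v d) = 0"
  by (simp add: vnorm_def)

lemma vnorm_le_sum_abs: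
  assumes "v \<in> carrier_vec d"
  shows "vnorm v \<le> (\<Sum>a<d. \<bar>vec_index v a\<bar>)"
  using L2_set_le_sum_abs[of "vec_index v" "{0..<d}"] assms
  by (simp add: vnorm_eq_L2_set lessThan_atLeast0)

text \<open>A crude bound of the operator norm, the sum of the norms of the rows: only the existence of a
  finite constant matters below.\<close>

definition op_bound :: "real mat \<Rightarrow> real" where
  "op_bound B = (\<Sum>a<dim_row B. vnorm (row B a))"

lemma op_bound_nonneg [simp]: "0 \<le> op_bound B"
  by (simp add: op_bound_def sum_nonneg)

lemma vnorm_mult_mat_vec_le:
  assumes "B \<in> carrier_mat r d" "v \<in> carrier_vec d"
  shows "vnorm (B *\<^sub>v v) \<le> op_bound B * vnorm v"
proof -
  have "vnorm (B *\<^sub>v v) \<le> (\<Sum>a<r. \<bar>vec_index (B *\<^sub>v v) a\<bar>)"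
    by (rule vnorm_le_sum_abs) (use assms in auto)
  also have "\<dots> = (\<Sum>a<r. \<bar>row B a \<bullet> v\<bar>)"
    using assms by (intro sum.cong) auto
  also have "\<dots> \<le> (\<Sum>a<r. vnorm (row B a) * vnorm v)"
    by (intro sum_mono abs_scalar_prod_le[of _ d]) (use assms in auto)
  also have "\<dots> = op_bound B * vnorm v"
    using assms by (simp add: op_bound_def sum_distrib_right)
  finally show ?thesis .
qed

lemma finsum_vec_in_carrier:
  fixes f :: "'i \<Rightarrow> real Matrix.vec"
  shows "(\<And>j. j \<in> F \<Longrightarrow> f j \<in> carrier_vec d) \<Longrightarrow> finsum_vec TYPE(real) d f F \<in> carrier_vec d"
  by (rule finsum_vec_closed) auto

lemma finsum_vec_cong:
  fixes f g :: "'i \<Rightarrow> real Matrix.vec"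
  assumes "finite F" "\<And>j. j \<in> F \<Longrightarrow> f j = g j" "\<And>j. j \<in> F \<Longrightarrow> f j \<in> carrier_vec d"
  shows "finsum_vec TYPE(real) d f F = finsum_vec TYPE(real) d g F"
  unfolding finsum_vec_def
  by (rule comm_monoid.finprod_cong'[OF comm_monoid_vec])
     (use assms in \<open>auto simp: monoid_vec_simps\<close>)

lemma scalar_prod_finsum_vec:
  fixes f :: "'i \<Rightarrow> real Matrix.vec"
  assumes "finite F" "\<And>j. j \<in> F \<Longrightarrow> f j \<in> carrier_vec d" "w \<in> carrier_vec d"
  shows "w \<bullet> finsum_vec TYPE(real) d f F = (\<Sum>j\<in>F. w \<bullet> f j)"
  using assms(1,2)
proof (induction F rule: finite_induct)
  case empty
  show ?case using assms(3) by (simp add: finsum_vec_empty)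
next
  case (insert j F)
  have *: "f \<in> F \<rightarrow> carrier_vec d" "f j \<in> carrier_vec d"
    using insert.prems by auto
  show ?case
    unfolding finsum_vec_insert[OF insert.hyps *]
    using insert * finsum_vec_closed[OF *(1)] assms(3)
    by (simp add: scalar_prod_add_distrib)
qed

lemma finsum_scalar_prod:
  fixes f :: "'i \<Rightarrow> real Matrix.vec"
  assumes "finite F" "\<And>j. j \<in> F \<Longrightarrow> f j \<in> carrier_vec d" "w \<in> carrier_vec d"
  shows "finsum_vec TYPE(real) d f F \<bullet> w = (\<Sum>j\<in>F. f j \<bullet> w)"
proof -
  have "finsum_vec TYPE(real) d f F \<bullet> w = w \<bullet> finsum_vec TYPE(real) d f F"
    by (rule comm_scalar_prod[OF finsum_vec_in_carrier assms(3)]) (use assms in auto)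
  also have "\<dots> = (\<Sum>j\<in>F. w \<bullet> f j)" by (rule scalar_prod_finsum_vec[OF assms])
  also have "\<dots> = (\<Sum>j\<in>F. f j \<bullet> w)"
    by (intro sum.cong refl comm_scalar_prod) (use assms in auto)
  finally show ?thesis .
qed

lemma finsum_vec_add:
  fixes f g :: "'i \<Rightarrow> real Matrix.vec"
  assumes "finite F" "\<And>j. j \<in> F \<Longrightarrow> f j \<in> carrier_vec d" "\<And>j. j \<in> F \<Longrightarrow> g j \<in> carrier_vec d"
  shows "finsum_vec TYPE(real) d (\<lambda>j. f j + g j) F
           = finsum_vec TYPE(real) d f F + finsum_vec TYPE(real) d g F"
proof -
  have "(\<lambda>j. f j + g j) \<in> F \<rightarrow> carrier_vec d" "f \<in> F \<rightarrow> carrier_vec d" "g \<in> F \<rightarrow> carrier_vec d"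
    using assms by auto
  note c = this finsum_vec_closed[OF this(1)] finsum_vec_closed[OF this(2)]
    finsum_vec_closed[OF this(3)]
  have "vec_index (f x + g x) a = vec_index (f x) a + vec_index (g x) a"
    if "x \<in> F" "a < d" for x a
    using assms(3)[OF that(1)] that(2) by simp
  then show ?thesis
    by (intro eq_vecI) (use assms(1) c in \<open>auto simp: index_finsum_vec sum.distrib\<close>)
qed

lemma finsum_vec_smult:
  fixes f :: "'i \<Rightarrow> real Matrix.vec"
  assumes "finite F" "\<And>j. j \<in> F \<Longrightarrow> f j \<in> carrier_vec d"
  shows "finsum_vec TYPE(real) d (\<lambda>j. r \<cdot>\<^sub>v f j) F = r \<cdot>\<^sub>v finsum_vec TYPE(real) d f F"
proof -
  have "(\<lambda>j. r \<cdot>\<^sub>v f j) \<in> F \<rightarrow> carrier_vec d" "f \<in> F \<rightarrow> carrier_vec d"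
    using assms by auto
  note c = this finsum_vec_closed[OF this(1)] finsum_vec_closed[OF this(2)]
  have "vec_index (r \<cdot>\<^sub>v f x) a = r * vec_index (f x) a" if "x \<in> F" "a < d" for x a
    using assms(2)[OF that(1)] that(2) by simp
  then show ?thesis
    by (intro eq_vecI) (use assms(1) c in \<open>auto simp: index_finsum_vec sum_distrib_left\<close>)
qed

lemma finsum_vec_minus:
  fixes f g :: "'i \<Rightarrow> real Matrix.vec"
  assumes "finite F" "\<And>j. j \<in> F \<Longrightarrow> f j \<in> carrier_vec d" "\<And>j. j \<in> F \<Longrightarrow> g j \<in> carrier_vec d"
  shows "finsum_vec TYPE(real) d (\<lambda>j. f j - g j) F
           = finsum_vec TYPE(real) d f F - finsum_vec TYPE(real) d g F"
proof -
  have "(\<lambda>j. f j - g j) \<in> F \<rightarrow> carrier_vec d" "f \<in> F \<rightarrow> carrier_vec d" "g \<in> F \<rightarrow> carrier_vec d"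
    using assms by auto
  note c = this finsum_vec_closed[OF this(1)] finsum_vec_closed[OF this(2)]
    finsum_vec_closed[OF this(3)]
  have "vec_index (f x - g x) a = vec_index (f x) a - vec_index (g x) a"
    if "x \<in> F" "a < d" for x a
    using assms(3)[OF that(1)] that(2) by simp
  then show ?thesis
    by (intro eq_vecI) (use assms(1) c in \<open>auto simp: index_finsum_vec sum_subtractf\<close>)
qed

lemma vnorm_finsum_vec_le:
  fixes f :: "'i \<Rightarrow> real Matrix.vec"
  assumes "finite F" "\<And>j. j \<in> F \<Longrightarrow> f j \<in> carrier_vec d"
  shows "vnorm (finsum_vec TYPE(real) d f F) \<le> (\<Sum>j\<in>F. vnorm (f j))"
  using assms
proof (induction F rule: finite_induct)
  case empty
  show ?case by (simp add: finsum_vec_empty)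
next
  case (insert j F)
  have *: "f \<in> F \<rightarrow> carrier_vec d" "f j \<in> carrier_vec d"
    using insert.prems by auto
  show ?case
    unfolding finsum_vec_insert[OF insert.hyps *]
    using insert * vnorm_add_le[OF *(2) finsum_vec_closed[OF *(1)]] by fastforce
qed

lemma finsum_mat_closed_mult:
  fixes X :: "'i \<Rightarrow> real mat"
  assumes "finite F" "\<And>j. j \<in> F \<Longrightarrow> X j \<in> carrier_mat d d"
  shows "finsum (ring_mat TYPE(real) d ()) X F \<in> carrier_mat d d"
    and "v \<in> carrier_vec d \<Longrightarrow>
      finsum (ring_mat TYPE(real) d ()) X F *\<^sub>v v = finsum_vec TYPE(real) d (\<lambda>j. X j *\<^sub>v v) F"
proof -
  interpret R: ring "ring_mat TYPE(real) d ()" by (rule ring_mat)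
  have cl: "finsum (ring_mat TYPE(real) d ()) X F \<in> carrier_mat d d"
    if "X \<in> F \<rightarrow> carrier_mat d d" for F
    using R.finsum_closed[of X F] that by (simp add: ring_mat_simps)
  show "finsum (ring_mat TYPE(real) d ()) X F \<in> carrier_mat d d"
    using cl assms by auto
  assume v: "v \<in> carrier_vec d"
  show "finsum (ring_mat TYPE(real) d ()) X F *\<^sub>v v = finsum_vec TYPE(real) d (\<lambda>j. X j *\<^sub>v v) F"
    using assms
  proof (induction F rule: finite_induct)
    case empty
    show ?case using v by (auto simp: finsum_vec_empty ring_mat_simps)
  next
    case (insert j F)
    have X: "X \<in> F \<rightarrow> carrier_mat d d" "X j \<in> carrier_mat d d" using insert.prems by auto
    have *: "(\<lambda>j. X j *\<^sub>v v) \<in> F \<rightarrow> carrier_vec d" "X j *\<^sub>v v \<in> carrier_vec d"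
      using X v by (auto dest: funcset_mem)
    have "finsum (ring_mat TYPE(real) d ()) X (insert j F)
        = X j + finsum (ring_mat TYPE(real) d ()) X F"
      using R.finsum_insert[OF insert.hyps, of X] X by (simp add: ring_mat_simps)
    then show ?case
      unfolding finsum_vec_insert[OF insert.hyps *]
      using insert add_mult_distrib_mat_vec[OF X(2) cl[OF X(1)] v] by simp
  qed
qed

lemma scalar_prod_finsum_mat:
  fixes X :: "'i \<Rightarrow> real mat"
  assumes "finite F" "\<And>j. j \<in> F \<Longrightarrow> X j \<in> carrier_mat d d" "v \<in> carrier_vec d" "w \<in> carrier_vec d"
  shows "v \<bullet> (finsum (ring_mat TYPE(real) d ()) X F *\<^sub>v w) = (\<Sum>j\<in>F. v \<bullet> (X j *\<^sub>v w))"
  using assms mult_mat_vec_carrier[OF assms(2,4)]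
  by (simp add: finsum_mat_closed_mult(2) scalar_prod_finsum_vec)

text \<open>A coercive matrix has a trivial kernel, so it is invertible. The norm bound is the estimate \<open>c
  |B w|^2 \<le> (B w) . (D B w) = (B w) . w \<le> |B w| |w|\<close>.\<close>

lemma mat_inverse_of_coercive:
  assumes D: "D \<in> carrier_mat d d" and c: "0 < c"
    and coercive: "\<And>v. v \<in> carrier_vec d \<Longrightarrow> c * (v \<bullet> v) \<le> v \<bullet> (D *\<^sub>v v)"
  obtains B where "mat_inverse D = Some B" "B \<in> carrier_mat d d" "D * B = 1\<^sub>m d"
    "\<And>w. w \<in> carrier_vec d \<Longrightarrow> vnorm (B *\<^sub>v w) \<le> vnorm w / c"
proof -
  have "Determinant.det D \<noteq> 0"
  proof
    assume "Determinant.det D = 0"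
    then obtain v where v: "v \<in> carrier_vec d" "v \<noteq> 0\<^sub>v d" "D *\<^sub>v v = 0\<^sub>v d"
      using det_0_iff_vec_prod_zero_field[OF D] by blast
    have "c * (v \<bullet> v) \<le> 0" using coercive[OF v(1)] v by simp
    thus False using scalar_prod_self_pos[OF v(1,2)] c by (simp add: mult_le_0_iff)
  qed
  then have "mat_inverse D \<noteq> None"
    using mat_inverse(1)[OF D, of "()"] det_non_zero_imp_unit[OF D, of "()"] by blast
  then obtain B where B: "mat_inverse D = Some B" by blast
  note inv = mat_inverse(2)[OF D B]
  have "vnorm (B *\<^sub>v w) \<le> vnorm w / c" if w: "w \<in> carrier_vec d" for w
  proof (cases "vnorm (B *\<^sub>v w) = 0")
    case True
    then show ?thesis using c by simp
  next
    case False
    have Bw: "B *\<^sub>v w \<in> carrier_vec d" using inv w by auto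
    have "(D * B) *\<^sub>v w = D *\<^sub>v (B *\<^sub>v w)"
      by (rule assoc_mult_mat_vec[OF D _ w]) (use inv in simp)
    then have DB: "D *\<^sub>v (B *\<^sub>v w) = w" using inv w by (metis one_mult_mat_vec)
    have "c * (vnorm (B *\<^sub>v w))\<^sup>2 \<le> (B *\<^sub>v w) \<bullet> w"
      using coercive[OF Bw] by (simp add: vnorm_square DB)
    also have "\<dots> \<le> vnorm (B *\<^sub>v w) * vnorm w"
      using abs_scalar_prod_le[OF Bw w] by linarith
    finally have "vnorm (B *\<^sub>v w) * (c * vnorm (B *\<^sub>v w)) \<le> vnorm (B *\<^sub>v w) * vnorm w"
      by (simp add: power2_eq_square algebra_simps)
    moreover have "0 < vnorm (B *\<^sub>v w)" using False vnorm_nonneg[of "B *\<^sub>v w"] by linarith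
    ultimately have "c * vnorm (B *\<^sub>v w) \<le> vnorm w" by (simp only: mult_le_cancel_left_pos)
    then show ?thesis using c by (simp add: field_simps)
  qed
  then show thesis using that B inv by blast
qed

section \<open>Two facts about real sequences and polynomials\<close>

text \<open>A discrete Halanay inequality. The rate \<open>\<rho>\<close> is chosen with \<open>\<rho>^(L+1) = q\<close>: if \<open>V\<close> is below \<open>C
  \<rho>^s\<close> on the window, hence below \<open>C \<rho>^(t-L)\<close>, then one factor \<open>q\<close> pays for the \<open>L + 1\<close> powers
  of \<open>\<rho>\<close> that separate \<open>t - L\<close> from \<open>t + 1\<close>. The constant \<open>C\<close> absorbs the values before \<open>t0\<close>.\<close>

lemma delayed_contraction_decay:
  fixes V :: "nat \<Rightarrow> real"
  assumes q: "0 < q" "q < 1"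
    and step: "\<And>t b. t0 \<le> t \<Longrightarrow> (\<And>s. t - L \<le> s \<Longrightarrow> s \<le> t \<Longrightarrow> V s \<le> b) \<Longrightarrow> V (Suc t) \<le> q * b"
  shows "\<exists>C>0. \<exists>\<rho>. 0 < \<rho> \<and> \<rho> < 1 \<and> (\<forall>t. V t \<le> C * \<rho> ^ t)"
proof -
  define \<rho> where "\<rho> = root (Suc L) q"
  have \<rho>: "0 < \<rho>" "\<rho> < 1" using q by (auto simp: \<rho>_def)
  have \<rho>q: "\<rho> ^ Suc L = q" unfolding \<rho>_def using q by (intro real_root_pow_pos2) auto
  define C where "C = 1 + (\<Sum>s\<le>t0. \<bar>V s\<bar> / \<rho> ^ s)"
  have C: "0 < C" unfolding C_def using \<rho> by (simp add: add_pos_nonneg sum_nonneg)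
  have "V t \<le> C * \<rho> ^ t" for t
  proof (induction t rule: less_induct)
    case (less t)
    show ?case
    proof (cases "t \<le> t0")
      case True
      have "\<bar>V t\<bar> / \<rho> ^ t \<le> (\<Sum>s\<le>t0. \<bar>V s\<bar> / \<rho> ^ s)"
        by (rule member_le_sum) (use True \<rho> in auto)
      then have "\<bar>V t\<bar> / \<rho> ^ t \<le> C" by (simp add: C_def)
      then show ?thesis using \<rho> by (simp add: field_simps)
    next
      case False
      then obtain r where r: "t = Suc r" "t0 \<le> r" by (cases t) auto
      have "V s \<le> C * \<rho> ^ (r - L)" if "r - L \<le> s" "s \<le> r" for s
      proof -
        have "V s \<le> C * \<rho> ^ s" using less that r by simp
        also have "\<dots> \<le> C * \<rho> ^ (r - L)"
          using C \<rho> that by (intro mult_left_mono power_decreasing) auto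
        finally show ?thesis .
      qed
      then have "V t \<le> q * (C * \<rho> ^ (r - L))" using step[OF r(2)] r(1) by blast
      also have "\<dots> = C * \<rho> ^ (Suc L + (r - L))" by (simp only: power_add \<rho>q mult_ac)
      also have "\<dots> \<le> C * \<rho> ^ t"
        using C \<rho> r by (intro mult_left_mono power_decreasing) auto
      finally show ?thesis .
    qed
  qed
  then show ?thesis using C \<rho> by blast
qed

text \<open>The first order condition at a minimum: near \<open>s = 0\<close> the linear term dominates, so it has to
  vanish.\<close>

lemma zero_if_quadratic_nonneg:
  fixes a b :: real
  assumes "\<And>s. 0 \<le> s * a + s\<^sup>2 * b"
  shows "a = 0"
proof (rule ccontr)
  assume "a \<noteq> 0"
  \<comment> \<open>At \<open>s = - a / k\<close> with \<open>k > b\<close> the quadratic is negative.\<close>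
  define k where "k = 1 + \<bar>b\<bar>"
  have "k > 0" "b < k" by (auto simp: k_def)
  have "0 \<le> (- a / k) * a + (- a / k)\<^sup>2 * b" by (rule assms)
  also have "\<dots> = a\<^sup>2 * (b - k) / k\<^sup>2"
    using \<open>k > 0\<close> by (simp add: field_simps power2_eq_square)
  also have "\<dots> < 0"
    using \<open>a \<noteq> 0\<close> \<open>k > 0\<close> \<open>b < k\<close> by (intro divide_neg_pos mult_pos_neg) auto
  finally show False by simp
qed

section \<open>The least squares problem in block form\<close>

context wls_problem
begin

abbreviation cn where "cn \<equiv> closed_neighbors G"

lemma cn_subset: "i \<in> {1..N} \<Longrightarrow> cn i \<subseteq> {1..N}"
proof -
  interpret pair_graph G by (rule graph)
  assume "i \<in> {1..N}"
  then show ?thesis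
    using in_arcsD2 nodes by (auto simp: closed_neighbors_def neighbors_def)
qed

lemma cn_vertex: "i \<in> {1..N} \<Longrightarrow> j \<in> cn i \<Longrightarrow> j \<in> {1..N}"
  using cn_subset by blast

lemma finite_cn: "i \<in> {1..N} \<Longrightarrow> finite (cn i)"
  using cn_subset finite_subset by blast

lemma cn_sym: "j \<in> cn i \<longleftrightarrow> i \<in> cn j"
proof -
  interpret pair_graph G by (rule graph)
  show ?thesis
    using pair_sym_arcs by (auto simp: closed_neighbors_def neighbors_def symmetric_def dest: symD)
qed

lemma self_cn [simp]: "i \<in> cn i"
  by (simp add: closed_neighbors_def)

lemma not_self_neighbor: "i \<notin> neighbors G i"
proof -
  interpret pair_graph G by (rule graph)
  show ?thesis using pair_no_loops[of "(i, i)"] by (auto simp: neighbors_def)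
qed

text \<open>Membership in the product space up to the values outside of \<open>{1..N}\<close>. In contrast to
  \<^const>\<open>state_space\<close> it is closed under pointwise arithmetic, since nothing is required there.\<close>

definition block_state :: "state \<Rightarrow> bool" where
  "block_state x \<longleftrightarrow> (\<forall>i\<in>{1..N}. x i \<in> carrier_vec (n i))"

lemma block_stateD: "block_state x \<Longrightarrow> i \<in> {1..N} \<Longrightarrow> x i \<in> carrier_vec (n i)"
  by (simp add: block_state_def)

definition wprod :: "nat \<Rightarrow> real Matrix.vec \<Rightarrow> real Matrix.vec \<Rightarrow> real" where
  "wprod j a b = a \<bullet> (W j *\<^sub>v b)"

lemma W_carrier: "j \<in> {1..N} \<Longrightarrow> W j \<in> carrier_mat (m j) (m j)"
  using W_pos_def by (simp add: pos_def_mat_def)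

lemma wprod_sym:
  assumes "j \<in> {1..N}" "a \<in> carrier_vec (m j)" "b \<in> carrier_vec (m j)"
  shows "wprod j a b = wprod j b a"
proof -
  have W: "W j \<in> carrier_mat (m j) (m j)" "transpose_mat (W j) = W j"
    using W_pos_def[OF assms(1)] by (auto simp: pos_def_mat_def)
  have "wprod j a b = (W j *\<^sub>v a) \<bullet> b"
    using transpose_vec_mult_scalar[OF W(1) assms(3,2)] W(2) by (simp add: wprod_def)
  also have "\<dots> = wprod j b a"
    unfolding wprod_def by (rule comm_scalar_prod) (use assms W in auto)
  finally show ?thesis .
qed

lemma wprod_nonneg:
  assumes "j \<in> {1..N}" "a \<in> carrier_vec (m j)"
  shows "0 \<le> wprod j a a"
proof (cases "a = 0\<^sub>v (m j)")
  case True
  then show ?thesis using W_carrier[OF assms(1)] by (simp add: wprod_def mult_mat_vec_def)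
next
  case False
  then show ?thesis using W_pos_def[OF assms(1)] assms(2) by (fastforce simp: wprod_def pos_def_mat_def)
qed

lemma wprod_add_right:
  assumes "j \<in> {1..N}" "a \<in> carrier_vec (m j)" "b \<in> carrier_vec (m j)" "c \<in> carrier_vec (m j)"
  shows "wprod j a (b + c) = wprod j a b + wprod j a c"
  using assms W_carrier[OF assms(1)] unfolding wprod_def
  by (simp add: mult_add_distrib_mat_vec scalar_prod_add_distrib[of _ "m j"])

lemma wprod_add_left:
  assumes "j \<in> {1..N}" "a \<in> carrier_vec (m j)" "b \<in> carrier_vec (m j)" "c \<in> carrier_vec (m j)"
  shows "wprod j (a + b) c = wprod j a c + wprod j b c"
  using assms W_carrier[OF assms(1)] unfolding wprod_def
  by (simp add: add_scalar_prod_distrib[of _ "m j"])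

lemma wprod_smult_right:
  assumes "j \<in> {1..N}" "a \<in> carrier_vec (m j)" "b \<in> carrier_vec (m j)"
  shows "wprod j a (r \<cdot>\<^sub>v b) = r * wprod j a b"
  using assms W_carrier[OF assms(1)] unfolding wprod_def
  by (simp add: mult_mat_vec)

lemma wprod_smult_left:
  assumes "j \<in> {1..N}" "a \<in> carrier_vec (m j)" "b \<in> carrier_vec (m j)"
  shows "wprod j (r \<cdot>\<^sub>v a) b = r * wprod j a b"
  using assms W_carrier[OF assms(1)] unfolding wprod_def
  by simp

text \<open>The noiseless measurement of agent \<open>j\<close> in state \<open>x\<close>; stacking over \<open>j\<close> gives \<open>A x\<close> for the
  block matrix \<open>A\<close>.\<close>

definition predict :: "nat \<Rightarrow> state \<Rightarrow> real Matrix.vec" where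
  "predict j x = finsum_vec TYPE(real) (m j) (\<lambda>k. A j k *\<^sub>v x k) (cn j)"

lemma A_mult_carrier:
  "j \<in> {1..N} \<Longrightarrow> k \<in> cn j \<Longrightarrow> v \<in> carrier_vec (n k) \<Longrightarrow> A j k *\<^sub>v v \<in> carrier_vec (m j)"
  using mult_mat_vec_carrier[OF A_dim] by blast

lemma block_state_cn: "block_state x \<Longrightarrow> j \<in> {1..N} \<Longrightarrow> k \<in> cn j \<Longrightarrow> x k \<in> carrier_vec (n k)"
  using cn_vertex block_stateD by blast

lemma predict_terms:
  assumes "j \<in> {1..N}" "block_state x" "k \<in> cn j"
  shows "A j k *\<^sub>v x k \<in> carrier_vec (m j)"
  using assms A_mult_carrier block_state_cn by blast

lemma predict_carrier: "j \<in> {1..N} \<Longrightarrow> block_state x \<Longrightarrow> predict j x \<in> carrier_vec (m j)"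
  unfolding predict_def by (rule finsum_vec_in_carrier) (rule predict_terms)

lemma predict_cong:
  assumes "j \<in> {1..N}" "block_state x" "\<And>k. k \<in> cn j \<Longrightarrow> x k = z k"
  shows "predict j x = predict j z"
  unfolding predict_def
  using assms predict_terms[OF assms(1,2)] by (intro finsum_vec_cong finite_cn) auto

lemma block_state_minus: "block_state x \<Longrightarrow> block_state z \<Longrightarrow> block_state (\<lambda>k. x k - z k)"
  by (simp add: block_state_def)

lemma block_state_add: "block_state x \<Longrightarrow> block_state z \<Longrightarrow> block_state (\<lambda>k. x k + z k)"
  by (simp add: block_state_def)

lemma block_state_smult: "block_state x \<Longrightarrow> block_state (\<lambda>k. r \<cdot>\<^sub>v x k)"
  by (simp add: block_state_def)

lemma predict_add:
  assumes "j \<in> {1..N}" "block_state x" "block_state z"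
  shows "predict j (\<lambda>k. x k + z k) = predict j x + predict j z"
proof -
  have "predict j (\<lambda>k. x k + z k)
      = finsum_vec TYPE(real) (m j) (\<lambda>k. A j k *\<^sub>v x k + A j k *\<^sub>v z k) (cn j)"
    unfolding predict_def
  proof (rule finsum_vec_cong)
    fix k assume k: "k \<in> cn j"
    show "A j k *\<^sub>v (x k + z k) = A j k *\<^sub>v x k + A j k *\<^sub>v z k"
      using A_dim[OF assms(1) k] block_state_cn[OF assms(2,1) k] block_state_cn[OF assms(3,1) k]
      by (rule mult_add_distrib_mat_vec)
    show "A j k *\<^sub>v (x k + z k) \<in> carrier_vec (m j)"
      by (rule predict_terms[OF assms(1) block_state_add[OF assms(2,3)] k])
  qed (rule finite_cn[OF assms(1)])
  also have "\<dots> = predict j x + predict j z"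
    unfolding predict_def
    by (rule finsum_vec_add) (use assms finite_cn predict_terms in auto)
  finally show ?thesis .
qed

lemma predict_minus:
  assumes "j \<in> {1..N}" "block_state x" "block_state z"
  shows "predict j (\<lambda>k. x k - z k) = predict j x - predict j z"
proof -
  have "predict j (\<lambda>k. x k - z k)
      = finsum_vec TYPE(real) (m j) (\<lambda>k. A j k *\<^sub>v x k - A j k *\<^sub>v z k) (cn j)"
    unfolding predict_def
  proof (rule finsum_vec_cong)
    fix k assume k: "k \<in> cn j"
    show "A j k *\<^sub>v (x k - z k) = A j k *\<^sub>v x k - A j k *\<^sub>v z k"
      using A_dim[OF assms(1) k] block_state_cn[OF assms(2,1) k] block_state_cn[OF assms(3,1) k]
      by (rule mult_minus_distrib_mat_vec)
    show "A j k *\<^sub>v (x k - z k) \<in> carrier_vec (m j)"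
      by (rule predict_terms[OF assms(1) block_state_minus[OF assms(2,3)] k])
  qed (rule finite_cn[OF assms(1)])
  also have "\<dots> = predict j x - predict j z"
    unfolding predict_def
    by (rule finsum_vec_minus) (use assms finite_cn predict_terms in auto)
  finally show ?thesis .
qed

lemma predict_smult:
  assumes "j \<in> {1..N}" "block_state x"
  shows "predict j (\<lambda>k. r \<cdot>\<^sub>v x k) = r \<cdot>\<^sub>v predict j x"
proof -
  have "predict j (\<lambda>k. r \<cdot>\<^sub>v x k)
      = finsum_vec TYPE(real) (m j) (\<lambda>k. r \<cdot>\<^sub>v (A j k *\<^sub>v x k)) (cn j)"
    unfolding predict_def
  proof (rule finsum_vec_cong)
    fix k assume k: "k \<in> cn j"
    show "A j k *\<^sub>v (r \<cdot>\<^sub>v x k) = r \<cdot>\<^sub>v (A j k *\<^sub>v x k)"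
      using A_dim[OF assms(1) k] block_state_cn[OF assms(2,1) k] by (rule mult_mat_vec)
    show "A j k *\<^sub>v (r \<cdot>\<^sub>v x k) \<in> carrier_vec (m j)"
      by (rule predict_terms[OF assms(1) block_state_smult[OF assms(2)] k])
  qed (rule finite_cn[OF assms(1)])
  also have "\<dots> = r \<cdot>\<^sub>v predict j x"
    unfolding predict_def
    by (rule finsum_vec_smult) (use assms finite_cn predict_terms in auto)
  finally show ?thesis .
qed

text \<open>Block \<open>i\<close> of \<open>A^T W z\<close>, the adjoint of \<open>predict\<close> for the weighted inner products. The gradient
  of \<open>J\<close> consists of the blocks \<open>backproject i (residual x)\<close>, and the sum of the vectors
  \<open>rho_hat i j\<close> of agent \<open>i\<close> becomes, after start-up, such a block for outdated residuals.\<close>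

definition backproject :: "nat \<Rightarrow> (nat \<Rightarrow> real Matrix.vec) \<Rightarrow> real Matrix.vec" where
  "backproject i z = finsum_vec TYPE(real) (n i) (\<lambda>j. (transpose_mat (A j i) * W j) *\<^sub>v z j) (cn i)"

lemma A_col_dim: "i \<in> {1..N} \<Longrightarrow> j \<in> cn i \<Longrightarrow> A j i \<in> carrier_mat (m j) (n i)"
  using A_dim[of j i] cn_sym cn_vertex by blast

lemma backproject_matrix_dim:
  assumes "i \<in> {1..N}" "j \<in> cn i"
  shows "transpose_mat (A j i) * W j \<in> carrier_mat (n i) (m j)"
  using A_col_dim[OF assms] W_carrier[OF cn_vertex[OF assms]] by auto

lemma backproject_terms:
  assumes "i \<in> {1..N}" "j \<in> cn i" "z \<in> carrier_vec (m j)"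
  shows "(transpose_mat (A j i) * W j) *\<^sub>v z \<in> carrier_vec (n i)"
  using backproject_matrix_dim[OF assms(1,2)] assms(3) by auto

lemma backproject_carrier:
  "i \<in> {1..N} \<Longrightarrow> (\<And>j. j \<in> cn i \<Longrightarrow> z j \<in> carrier_vec (m j)) \<Longrightarrow> backproject i z \<in> carrier_vec (n i)"
  unfolding backproject_def by (rule finsum_vec_in_carrier) (rule backproject_terms)

lemma scalar_prod_backproject_term:
  assumes "i \<in> {1..N}" "j \<in> cn i" "z \<in> carrier_vec (m j)" "v \<in> carrier_vec (n i)"
  shows "v \<bullet> ((transpose_mat (A j i) * W j) *\<^sub>v z) = wprod j (A j i *\<^sub>v v) z"
proof -
  note A = A_col_dim[OF assms(1,2)] and W = W_carrier[OF cn_vertex[OF assms(1,2)]]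
  have c: "A j i *\<^sub>v v \<in> carrier_vec (m j)" "W j *\<^sub>v z \<in> carrier_vec (m j)"
    using A W assms by auto
  have "v \<bullet> ((transpose_mat (A j i) * W j) *\<^sub>v z) = v \<bullet> (transpose_mat (A j i) *\<^sub>v (W j *\<^sub>v z))"
    using A W assms by simp
  also have "\<dots> = (transpose_mat (A j i) *\<^sub>v (W j *\<^sub>v z)) \<bullet> v"
    by (rule comm_scalar_prod[of _ "n i"]) (use A c assms in auto)
  also have "\<dots> = (W j *\<^sub>v z) \<bullet> (A j i *\<^sub>v v)"
    by (rule transpose_vec_mult_scalar[OF A assms(4) c(2)])
  also have "\<dots> = wprod j (A j i *\<^sub>v v) z"
    unfolding wprod_def by (rule comm_scalar_prod[OF c(2,1)])
  finally show ?thesis .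
qed

lemma scalar_prod_backproject:
  assumes "i \<in> {1..N}" "\<And>j. j \<in> cn i \<Longrightarrow> z j \<in> carrier_vec (m j)" "v \<in> carrier_vec (n i)"
  shows "v \<bullet> backproject i z = (\<Sum>j\<in>cn i. wprod j (A j i *\<^sub>v v) (z j))"
  unfolding backproject_def
  by (subst scalar_prod_finsum_vec[where d = "n i"])
     (use assms finite_cn backproject_terms scalar_prod_backproject_term in auto)

text \<open>The adjointness \<open>e . (A^T W z) = (A e) . (W z)\<close>. Exchanging the two sums uses the symmetry of
  the graph: \<open>i\<close> hears about the residual of \<open>j\<close> exactly if \<open>x_i\<close> enters the cost of \<open>j\<close>.\<close>

lemma sum_scalar_prod_backproject:
  assumes e: "block_state e" and z: "\<And>j. j \<in> {1..N} \<Longrightarrow> z j \<in> carrier_vec (m j)"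
  shows "(\<Sum>i\<in>{1..N}. e i \<bullet> backproject i z) = (\<Sum>j\<in>{1..N}. wprod j (predict j e) (z j))"
proof -
  have "(\<Sum>i\<in>{1..N}. e i \<bullet> backproject i z)
      = (\<Sum>i\<in>{1..N}. \<Sum>j\<in>cn i. wprod j (A j i *\<^sub>v e i) (z j))"
    by (intro sum.cong refl scalar_prod_backproject) (use e z cn_vertex block_stateD in blast)+
  also have "\<dots> = (\<Sum>i\<in>{1..N}. \<Sum>j\<in>{1..N}. if j \<in> cn i then wprod j (A j i *\<^sub>v e i) (z j) else 0)"
  proof (rule sum.cong[OF refl])
    fix i assume "i \<in> {1..N}"
    then have "{1..N} \<inter> cn i = cn i" using cn_subset by blast
    then show "(\<Sum>j\<in>cn i. wprod j (A j i *\<^sub>v e i) (z j))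
        = (\<Sum>j\<in>{1..N}. if j \<in> cn i then wprod j (A j i *\<^sub>v e i) (z j) else 0)"
      by (simp flip: sum.inter_restrict)
  qed
  also have "\<dots> = (\<Sum>j\<in>{1..N}. \<Sum>i\<in>{1..N}. if i \<in> cn j then wprod j (A j i *\<^sub>v e i) (z j) else 0)"
    by (subst sum.swap) (simp add: cn_sym)
  also have "\<dots> = (\<Sum>j\<in>{1..N}. wprod j (predict j e) (z j))"
  proof (intro sum.cong refl)
    fix j assume j: "j \<in> {1..N}"
    then have *: "{1..N} \<inter> cn j = cn j" using cn_subset by blast
    have "W j *\<^sub>v z j \<in> carrier_vec (m j)" using W_carrier[OF j] z[OF j] by auto
    then have "wprod j (predict j e) (z j) = (\<Sum>i\<in>cn j. wprod j (A j i *\<^sub>v e i) (z j))"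
      unfolding wprod_def predict_def
      using finsum_scalar_prod[OF finite_cn[OF j], of "\<lambda>k. A j k *\<^sub>v e k" "m j"]
        predict_terms[OF j e] by blast
    then show "(\<Sum>i\<in>{1..N}. if i \<in> cn j then wprod j (A j i *\<^sub>v e i) (z j) else 0)
        = wprod j (predict j e) (z j)"
      using * sum.inter_restrict[of "{1..N}" "\<lambda>i. wprod j (A j i *\<^sub>v e i) (z j)" "cn j"] by simp
  qed
  finally show ?thesis .
qed

lemma backproject_minus:
  assumes i: "i \<in> {1..N}" and z: "\<And>j. j \<in> cn i \<Longrightarrow> z j \<in> carrier_vec (m j)"
    "\<And>j. j \<in> cn i \<Longrightarrow> z' j \<in> carrier_vec (m j)"
  shows "backproject i (\<lambda>j. z j - z' j) = backproject i z - backproject i z'"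
proof -
  have "backproject i (\<lambda>j. z j - z' j) = finsum_vec TYPE(real) (n i)
      (\<lambda>j. (transpose_mat (A j i) * W j) *\<^sub>v z j - (transpose_mat (A j i) * W j) *\<^sub>v z' j) (cn i)"
    unfolding backproject_def
  proof (rule finsum_vec_cong)
    fix j assume j: "j \<in> cn i"
    show "(transpose_mat (A j i) * W j) *\<^sub>v (z j - z' j)
      = (transpose_mat (A j i) * W j) *\<^sub>v z j - (transpose_mat (A j i) * W j) *\<^sub>v z' j"
      using backproject_matrix_dim[OF i j] z(1)[OF j] z(2)[OF j] by (rule mult_minus_distrib_mat_vec)
    show "(transpose_mat (A j i) * W j) *\<^sub>v (z j - z' j) \<in> carrier_vec (n i)"
      by (rule backproject_terms[OF i j]) (use z j in auto)
  qed (rule finite_cn[OF i])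
  also have "\<dots> = backproject i z - backproject i z'"
    unfolding backproject_def
    by (rule finsum_vec_minus) (use assms finite_cn backproject_terms in auto)
  finally show ?thesis .
qed

definition backproject_bound :: real where
  "backproject_bound = (\<Sum>i\<in>{1..N}. \<Sum>j\<in>cn i. op_bound (transpose_mat (A j i) * W j) * (\<Sum>k\<in>cn j. op_bound (A j k)))"

text \<open>The states \<open>d j\<close> may differ from one residual \<open>j\<close> to another, because agent \<open>i\<close> combines
  residuals that were computed at different times.\<close>

lemma vnorm_backproject_predict_le:
  assumes i: "i \<in> {1..N}" and d: "\<And>j. j \<in> cn i \<Longrightarrow> block_state (d j)"
    and b: "\<And>j k. j \<in> cn i \<Longrightarrow> k \<in> cn j \<Longrightarrow> vnorm (d j k) \<le> b" and b0: "0 \<le> b"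
  shows "vnorm (backproject i (\<lambda>j. predict j (d j))) \<le> backproject_bound * b"
proof -
  have p: "vnorm (predict j (d j)) \<le> (\<Sum>k\<in>cn j. op_bound (A j k)) * b" if j: "j \<in> cn i" for j
  proof -
    note jN = cn_vertex[OF i j]
    have "vnorm (predict j (d j)) \<le> (\<Sum>k\<in>cn j. vnorm (A j k *\<^sub>v d j k))"
      unfolding predict_def
      by (rule vnorm_finsum_vec_le) (use finite_cn jN predict_terms d j in auto)
    also have "\<dots> \<le> (\<Sum>k\<in>cn j. op_bound (A j k) * b)"
    proof (rule sum_mono)
      fix k assume k: "k \<in> cn j"
      have "vnorm (A j k *\<^sub>v d j k) \<le> op_bound (A j k) * vnorm (d j k)"
        using A_dim[OF jN k] block_state_cn[OF d[OF j] jN k] by (rule vnorm_mult_mat_vec_le)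
      also have "\<dots> \<le> op_bound (A j k) * b" using b[OF j k] by (simp add: mult_left_mono)
      finally show "vnorm (A j k *\<^sub>v d j k) \<le> op_bound (A j k) * b" .
    qed
    finally show ?thesis by (simp add: sum_distrib_right)
  qed
  have pc: "predict j (d j) \<in> carrier_vec (m j)" if "j \<in> cn i" for j
    using predict_carrier cn_vertex[OF i that] d[OF that] by blast
  have "vnorm (backproject i (\<lambda>j. predict j (d j)))
      \<le> (\<Sum>j\<in>cn i. vnorm ((transpose_mat (A j i) * W j) *\<^sub>v predict j (d j)))"
    unfolding backproject_def
    by (rule vnorm_finsum_vec_le) (use finite_cn i backproject_terms pc in auto)
  also have "\<dots> \<le> (\<Sum>j\<in>cn i. op_bound (transpose_mat (A j i) * W j) * ((\<Sum>k\<in>cn j. op_bound (A j k)) * b))"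
  proof (rule sum_mono)
    fix j assume j: "j \<in> cn i"
    have "vnorm ((transpose_mat (A j i) * W j) *\<^sub>v predict j (d j))
        \<le> op_bound (transpose_mat (A j i) * W j) * vnorm (predict j (d j))"
      using backproject_matrix_dim[OF i j] pc[OF j] by (rule vnorm_mult_mat_vec_le)
    also have "\<dots> \<le> op_bound (transpose_mat (A j i) * W j) * ((\<Sum>k\<in>cn j. op_bound (A j k)) * b)"
      using p[OF j] by (simp add: mult_left_mono)
    finally show "vnorm ((transpose_mat (A j i) * W j) *\<^sub>v predict j (d j)) \<le> \<dots>" .
  qed
  also have "\<dots> = (\<Sum>j\<in>cn i. op_bound (transpose_mat (A j i) * W j) * (\<Sum>k\<in>cn j. op_bound (A j k))) * b"
    by (simp add: sum_distrib_right mult.assoc)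
  also have "\<dots> \<le> backproject_bound * b"
    unfolding backproject_bound_def
    by (intro mult_right_mono[OF member_le_sum] b0)
       (use i in \<open>auto intro!: sum_nonneg mult_nonneg_nonneg\<close>)
  finally show ?thesis .
qed

lemma backproject_bound_nonneg: "0 \<le> backproject_bound"
  unfolding backproject_bound_def by (auto intro!: sum_nonneg mult_nonneg_nonneg)

section \<open>Coercivity of the cost\<close>

text \<open>The quadratic form \<open>e . H e\<close> of the Hessian \<open>H\<close> of \<open>J\<close>.\<close>

definition hess_form :: "state \<Rightarrow> real" where
  "hess_form e = (\<Sum>j\<in>{1..N}. wprod j (predict j e) (predict j e))"

definition residual :: "state \<Rightarrow> nat \<Rightarrow> real Matrix.vec" where
  "residual x j = predict j x - y j"

lemma residual_carrier: "j \<in> {1..N} \<Longrightarrow> block_state x \<Longrightarrow> residual x j \<in> carrier_vec (m j)"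
  unfolding residual_def using predict_carrier y_dim by auto

lemma wprod_minus_swap:
  assumes "j \<in> {1..N}" "a \<in> carrier_vec (m j)" "b \<in> carrier_vec (m j)"
  shows "wprod j (a - b) (a - b) = wprod j (b - a) (b - a)"
proof -
  have "a - b = (-1) \<cdot>\<^sub>v (b - a)" using assms by (intro eq_vecI) auto
  then have "wprod j (a - b) (a - b) = (-1) * ((-1) * wprod j (b - a) (b - a))"
    using assms by (simp add: wprod_smult_left wprod_smult_right del: mult_minus1)
  then show ?thesis by simp
qed

lemma J_eq_residual:
  assumes "block_state x"
  shows "J x = (\<Sum>j\<in>{1..N}. wprod j (residual x j) (residual x j)) / 2"
proof -
  have "local_cost j x = wprod j (residual x j) (residual x j) / 2" if j: "j \<in> {1..N}" for j
    using wprod_minus_swap[OF j y_dim[OF j] predict_carrier[OF j assms]]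
    by (simp add: local_cost_def Let_def residual_def wprod_def predict_def)
  then show ?thesis unfolding J_def sum_divide_distrib by (rule sum.cong[OF refl])
qed

text \<open>The exact second order Taylor expansion of the quadratic function \<open>J\<close>.\<close>

lemma J_perturb:
  assumes x: "block_state x" and e: "block_state e"
  shows "J (\<lambda>i. x i + s \<cdot>\<^sub>v e i)
    = J x + s * (\<Sum>i\<in>{1..N}. e i \<bullet> backproject i (residual x)) + s\<^sup>2 * (hess_form e / 2)"
proof -
  have bs: "block_state (\<lambda>i. s \<cdot>\<^sub>v e i)" by (rule block_state_smult[OF e])
  have "wprod j (residual (\<lambda>i. x i + s \<cdot>\<^sub>v e i) j) (residual (\<lambda>i. x i + s \<cdot>\<^sub>v e i) j)
     = wprod j (residual x j) (residual x j) + 2 * s * wprod j (predict j e) (residual x j)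
      + s\<^sup>2 * wprod j (predict j e) (predict j e)" if j: "j \<in> {1..N}" for j
  proof -
    note c = residual_carrier[OF j x] predict_carrier[OF j e] predict_carrier[OF j x] y_dim[OF j]
    have r: "residual (\<lambda>i. x i + s \<cdot>\<^sub>v e i) j = residual x j + s \<cdot>\<^sub>v predict j e"
      unfolding residual_def predict_add[OF j x bs] predict_smult[OF j e]
      using c by (intro eq_vecI) auto
    show ?thesis
      unfolding r using c j wprod_sym[OF j c(1,2)]
      by (simp add: wprod_add_left wprod_add_right wprod_smult_left wprod_smult_right
          power2_eq_square algebra_simps)
  qed
  then have "J (\<lambda>i. x i + s \<cdot>\<^sub>v e i) = (\<Sum>j\<in>{1..N}.
       wprod j (residual x j) (residual x j) + 2 * s * wprod j (predict j e) (residual x j)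
      + s\<^sup>2 * wprod j (predict j e) (predict j e)) / 2"
    by (simp add: J_eq_residual[OF block_state_add[OF x bs]])
  also have "\<dots> = J x + s * (\<Sum>j\<in>{1..N}. wprod j (predict j e) (residual x j))
      + s\<^sup>2 * (hess_form e / 2)"
    unfolding J_eq_residual[OF x] hess_form_def sum.distrib sum_distrib_left[symmetric]
    by (simp add: field_simps)
  finally show ?thesis
    using sum_scalar_prod_backproject[OF e, of "residual x"] residual_carrier[OF _ x] by simp
qed

text \<open>The cost reads the blocks in \<open>{1..N}\<close> only, so hypotheses about the extensional \<^const>\<open>state_space\<close>
  transfer to arbitrary \<^const>\<open>block_state\<close>s.\<close>

lemma J_restrict:
  assumes "block_state x"
  shows "J (\<lambda>i\<in>{1..N}. x i) = J x"
proof -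
  have b: "block_state (\<lambda>i\<in>{1..N}. x i)" using assms by (simp add: block_state_def)
  have "predict j (\<lambda>i\<in>{1..N}. x i) = predict j x" if "j \<in> {1..N}" for j
    by (rule predict_cong[OF that b]) (use cn_vertex[OF that] in simp)
  then have "residual (\<lambda>i\<in>{1..N}. x i) j = residual x j" if "j \<in> {1..N}" for j
    using that by (simp add: residual_def)
  then show ?thesis unfolding J_eq_residual[OF b] J_eq_residual[OF assms]
    by (intro arg_cong[where f = "\<lambda>s. s / 2"] sum.cong refl) simp
qed

lemma restrict_in_state_space: "block_state x \<Longrightarrow> (\<lambda>i\<in>{1..N}. x i) \<in> state_space N n"
  by (simp add: state_space_def block_state_def)

lemma state_space_block: "x \<in> state_space N n \<Longrightarrow> block_state x"
  by (auto simp: state_space_def block_state_def)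

lemma state_norm_eq: "state_norm N x = L2_set (\<lambda>i. vnorm (x i)) {1..N}"
  by (simp add: state_norm_def L2_set_def vnorm_square)

lemma minimizer_le:
  assumes "unique_minimizer N n J xs" "block_state x"
  shows "J xs \<le> J x"
proof (cases "(\<lambda>i\<in>{1..N}. x i) = xs")
  case True
  then show ?thesis using J_restrict[OF assms(2)] by simp
next
  case False
  then have "J xs < J (\<lambda>i\<in>{1..N}. x i)"
    using assms(1) restrict_in_state_space[OF assms(2)] unfolding unique_minimizer_def by blast
  then show ?thesis using J_restrict[OF assms(2)] by simp
qed

definition single :: "nat \<Rightarrow> real Matrix.vec \<Rightarrow> state" where
  "single i v = (\<lambda>k. if k = i then v else 0\<^sub>v (n k))"

lemma single_block: "i \<in> {1..N} \<Longrightarrow> v \<in> carrier_vec (n i) \<Longrightarrow> block_state (single i v)"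
  by (auto simp: single_def block_state_def)

text \<open>The gradient is orthogonal to each direction; choosing the direction equal to the \<open>i\<close>-th
  gradient block shows that this block vanishes.\<close>

lemma stationary:
  assumes "unique_minimizer N n J xs"
  shows "\<And>e. block_state e \<Longrightarrow> (\<Sum>i\<in>{1..N}. e i \<bullet> backproject i (residual xs)) = 0"
    and "\<And>i. i \<in> {1..N} \<Longrightarrow> backproject i (residual xs) = 0\<^sub>v (n i)"
proof -
  have xs: "block_state xs" using assms state_space_block unfolding unique_minimizer_def by blast
  show g: "(\<Sum>i\<in>{1..N}. e i \<bullet> backproject i (residual xs)) = 0" if e: "block_state e" for e
  proof (rule zero_if_quadratic_nonneg)
    fix s
    show "0 \<le> s * (\<Sum>i\<in>{1..N}. e i \<bullet> backproject i (residual xs)) + s\<^sup>2 * (hess_form e / 2)"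
      using minimizer_le[OF assms block_state_add[OF xs block_state_smult[OF e]], of s]
        J_perturb[OF xs e, of s] by simp
  qed
  show "backproject i (residual xs) = 0\<^sub>v (n i)" if i: "i \<in> {1..N}" for i
  proof -
    have c: "backproject k (residual xs) \<in> carrier_vec (n k)" if "k \<in> {1..N}" for k
      using backproject_carrier[OF that] residual_carrier[OF _ xs] cn_vertex[OF that] by blast
    define g where "g = backproject i (residual xs)"
    have gc: "g \<in> carrier_vec (n i)" using c[OF i] by (simp add: g_def)
    have "0 = (\<Sum>k\<in>{1..N}. single i g k \<bullet> backproject k (residual xs))"
      using g[OF single_block[OF i gc]] by simp
    also have "\<dots> = (\<Sum>k\<in>{1..N}. if k = i then g \<bullet> g else 0)"
      by (rule sum.cong[OF refl]) (use c in \<open>auto simp: single_def g_def\<close>)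
    also have "\<dots> = g \<bullet> g" using i by (simp add: sum.delta)
    finally show ?thesis using scalar_prod_self_pos[OF gc] by (auto simp: g_def)
  qed
qed

lemma J_above_minimum:
  assumes "unique_minimizer N n J xs" "block_state e"
  shows "J (\<lambda>i. xs i + s \<cdot>\<^sub>v e i) = J xs + s\<^sup>2 * (hess_form e / 2)"
  using J_perturb[OF state_space_block assms(2), of xs s] stationary(1)[OF assms] assms(1)
  by (simp add: unique_minimizer_def)

lemma hess_form_nonneg: "block_state e \<Longrightarrow> 0 \<le> hess_form e"
  unfolding hess_form_def by (intro sum_nonneg wprod_nonneg predict_carrier)

lemma state_norm_square: "(state_norm N e)\<^sup>2 = (\<Sum>i\<in>{1..N}. e i \<bullet> e i)"
  by (simp add: state_norm_def sum_nonneg scalar_prod_self_nonneg)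

text \<open>Radial unboundedness yields a radius \<open>R\<close> such that \<open>J\<close> exceeds its minimum by more than \<open>1/2\<close>
  at \<open>x* + e\<close> as soon as \<open>|e| = R\<close>, that is \<open>e . H e \<ge> 1\<close> on that sphere. Homogeneity extends
  this to \<open>e . H e \<ge> |e|^2 / R^2\<close> everywhere.\<close>

lemma hess_form_coercive:
  assumes rad: "radially_unbounded N n J" and min: "unique_minimizer N n J xs"
  obtains c where "0 < c" "\<And>e. block_state e \<Longrightarrow> c * (\<Sum>i\<in>{1..N}. e i \<bullet> e i) \<le> hess_form e"
proof -
  obtain r where r: "\<And>x. x \<in> state_space N n \<Longrightarrow> r < state_norm N x \<Longrightarrow> J xs + 1 / 2 < J x"
    using rad unfolding radially_unbounded_def by blast
  \<comment> \<open>Points at distance \<open>R\<close> from the minimizer have norm larger than \<open>r\<close>.\<close>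
  define R where "R = \<bar>r\<bar> + state_norm N xs + 1"
  have xs: "block_state xs" using min state_space_block unfolding unique_minimizer_def by blast
  have nn: "0 \<le> state_norm N x" for x by (simp add: state_norm_eq)
  have R: "0 < R" unfolding R_def using nn[of xs] by simp
  have "1 / R\<^sup>2 * (\<Sum>i\<in>{1..N}. e i \<bullet> e i) \<le> hess_form e" if e: "block_state e" for e
  proof (cases "state_norm N e = 0")
    case True
    then show ?thesis using state_norm_square[of e] hess_form_nonneg[OF e] by simp
  next
    case False
    then have pos: "0 < state_norm N e" using nn[of e] by linarith
    define s where "s = R / state_norm N e"
    have s: "0 < s" using pos R by (simp add: s_def)
    define x where "x = (\<lambda>i. xs i + s \<cdot>\<^sub>v e i)"
    have x: "block_state x"
      unfolding x_def by (rule block_state_add[OF xs block_state_smult[OF e]])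
    have tri: "vnorm (s \<cdot>\<^sub>v e i) \<le> vnorm (x i) + vnorm (xs i)" if i: "i \<in> {1..N}" for i
    proof -
      have c: "x i \<in> carrier_vec (n i)" "xs i \<in> carrier_vec (n i)" "e i \<in> carrier_vec (n i)"
        using block_stateD i x xs e by auto
      have "s \<cdot>\<^sub>v e i = x i + (-1) \<cdot>\<^sub>v xs i" unfolding x_def using c by (intro eq_vecI) auto
      then show ?thesis
        using vnorm_add_le[OF c(1), of "(-1) \<cdot>\<^sub>v xs i"] c(2) by (simp add: vnorm_smult)
    qed
    have "L2_set (\<lambda>i. vnorm (s \<cdot>\<^sub>v e i)) {1..N} = s * state_norm N e"
      using s L2_set_right_distrib[of s "\<lambda>i. vnorm (e i)"] by (simp add: vnorm_smult state_norm_eq)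
    then have "R = L2_set (\<lambda>i. vnorm (s \<cdot>\<^sub>v e i)) {1..N}" using pos by (simp add: s_def)
    also have "\<dots> \<le> L2_set (\<lambda>i. vnorm (x i) + vnorm (xs i)) {1..N}"
      by (rule L2_set_mono) (use tri in auto)
    also have "\<dots> \<le> state_norm N x + state_norm N xs"
      unfolding state_norm_eq by (rule L2_set_triangle_ineq)
    finally have "r < state_norm N (\<lambda>i\<in>{1..N}. x i)"
      by (simp add: R_def state_norm_def)
    then have "J xs + 1 / 2 < J (\<lambda>i\<in>{1..N}. x i)" by (rule r[OF restrict_in_state_space[OF x]])
    also have "\<dots> = J xs + s\<^sup>2 * (hess_form e / 2)"
      unfolding J_restrict[OF x] unfolding x_def by (rule J_above_minimum[OF min e])
    finally have "1 \<le> s\<^sup>2 * hess_form e" by simp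
    then have "(state_norm N e)\<^sup>2 \<le> R\<^sup>2 * hess_form e"
      using pos by (simp add: s_def power_divide field_simps)
    then show ?thesis
      unfolding state_norm_square[symmetric] using R by (simp add: field_simps)
  qed
  then show thesis using that[of "1 / R\<^sup>2"] R by simp
qed

text \<open>The \<open>i\<close>-th diagonal block of the Hessian, which is the preconditioner of agent \<open>i\<close> as soon as
  it has heard from all its neighbors.\<close>

definition hess_block :: "nat \<Rightarrow> real mat" where
  "hess_block i = finsum (ring_mat TYPE(real) (n i) ()) (\<lambda>j. xi j i) (cn i)"

lemma xi_carrier: "i \<in> {1..N} \<Longrightarrow> j \<in> cn i \<Longrightarrow> xi j i \<in> carrier_mat (n i) (n i)"
  unfolding xi_def by (rule mult_carrier_mat[OF backproject_matrix_dim A_col_dim])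

lemma scalar_prod_xi:
  assumes i: "i \<in> {1..N}" and j: "j \<in> cn i" and v: "v \<in> carrier_vec (n i)" "w \<in> carrier_vec (n i)"
  shows "v \<bullet> (xi j i *\<^sub>v w) = wprod j (A j i *\<^sub>v v) (A j i *\<^sub>v w)"
proof -
  have "xi j i *\<^sub>v w = (transpose_mat (A j i) * W j) *\<^sub>v (A j i *\<^sub>v w)"
    unfolding xi_def
    by (rule assoc_mult_mat_vec[OF backproject_matrix_dim[OF i j] A_col_dim[OF i j] v(2)])
  then show ?thesis
    using scalar_prod_backproject_term[OF i j _ v(1)] mult_mat_vec_carrier[OF A_col_dim[OF i j] v(2)]
    by simp
qed

lemma hess_block_carrier: "i \<in> {1..N} \<Longrightarrow> hess_block i \<in> carrier_mat (n i) (n i)"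
  unfolding hess_block_def by (rule finsum_mat_closed_mult(1)[OF finite_cn xi_carrier])

lemma scalar_prod_hess_block:
  assumes i: "i \<in> {1..N}" and v: "v \<in> carrier_vec (n i)" "w \<in> carrier_vec (n i)"
  shows "v \<bullet> (hess_block i *\<^sub>v w) = (\<Sum>j\<in>cn i. wprod j (A j i *\<^sub>v v) (A j i *\<^sub>v w))"
  unfolding hess_block_def using scalar_prod_finsum_mat[OF finite_cn[OF i] xi_carrier[OF i] v]
    scalar_prod_xi[OF i _ v] by simp

lemma hess_block_sym:
  assumes i: "i \<in> {1..N}" and v: "v \<in> carrier_vec (n i)" "w \<in> carrier_vec (n i)"
  shows "v \<bullet> (hess_block i *\<^sub>v w) = w \<bullet> (hess_block i *\<^sub>v v)"
proof -
  have "wprod j (A j i *\<^sub>v v) (A j i *\<^sub>v w) = wprod j (A j i *\<^sub>v w) (A j i *\<^sub>v v)"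
    if j: "j \<in> cn i" for j
    by (rule wprod_sym[OF cn_vertex[OF i j]])
       (rule mult_mat_vec_carrier[OF A_col_dim[OF i j]], rule v)+
  then show ?thesis using scalar_prod_hess_block[OF i v] scalar_prod_hess_block[OF i v(2,1)] by simp
qed

lemma predict_single:
  assumes j: "j \<in> {1..N}" and i: "i \<in> {1..N}" and v: "v \<in> carrier_vec (n i)"
  shows "predict j (single i v) = (if i \<in> cn j then A j i *\<^sub>v v else 0\<^sub>v (m j))"
proof (cases "i \<in> cn j")
  case True
  have "predict j (single i v) = finsum_vec TYPE(real) (m j)
      (\<lambda>k. A j k *\<^sub>v single i v k) (insert i (cn j - {i}))"
    unfolding predict_def using True by (simp add: insert_absorb)
  also have "\<dots> = A j i *\<^sub>v single i v i + finsum_vec TYPE(real) (m j)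
      (\<lambda>k. A j k *\<^sub>v single i v k) (cn j - {i})"
    by (rule finsum_vec_insert)
       (use True finite_cn[OF j] predict_terms[OF j single_block[OF i v]] in auto)
  also have "finsum_vec TYPE(real) (m j) (\<lambda>k. A j k *\<^sub>v single i v k) (cn j - {i}) = 0\<^sub>v (m j)"
    (is "?z = _")
  proof -
    have z: "A j k *\<^sub>v single i v k = 0\<^sub>v (m j)" if "k \<in> cn j - {i}" for k
      using A_dim[OF j, of k] that by (auto simp: single_def mult_mat_vec_def intro!: eq_vecI)
    have "?z = finsum_vec TYPE(real) (m j) (\<lambda>k. 0\<^sub>v (m j)) (cn j - {i})"
      by (rule finsum_vec_cong) (use z finite_cn[OF j] in auto)
    also have "\<dots> = 0\<^sub>v (m j)"
      using finite_cn[OF j] by (intro eq_vecI) (auto simp: index_finsum_vec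
          carrier_vecD[OF finsum_vec_in_carrier])
    finally show ?thesis .
  qed
  finally show ?thesis
    using True mult_mat_vec_carrier[OF A_dim[OF j True] v] by (simp add: single_def)
next
  case False
  have z: "A j k *\<^sub>v single i v k = 0\<^sub>v (m j)" if "k \<in> cn j" for k
    using A_dim[OF j, of k] that False by (auto simp: single_def mult_mat_vec_def intro!: eq_vecI)
  have "predict j (single i v) = finsum_vec TYPE(real) (m j) (\<lambda>k. 0\<^sub>v (m j)) (cn j)"
    unfolding predict_def by (rule finsum_vec_cong) (use z finite_cn[OF j] in auto)
  also have "\<dots> = 0\<^sub>v (m j)"
    using finite_cn[OF j] by (intro eq_vecI) (auto simp: index_finsum_vec
        carrier_vecD[OF finsum_vec_in_carrier])
  finally show ?thesis using False by simp
qed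

text \<open>The diagonal blocks are the restrictions of the Hessian form to the states supported in one
  block; this makes them coercive with the same constant.\<close>

lemma hess_form_single:
  assumes i: "i \<in> {1..N}" and v: "v \<in> carrier_vec (n i)"
  shows "hess_form (single i v) = v \<bullet> (hess_block i *\<^sub>v v)"
proof -
  have z: "wprod j (0\<^sub>v (m j)) (0\<^sub>v (m j)) = 0" if "j \<in> {1..N}" for j
    using mult_mat_vec_carrier[OF W_carrier[OF that], of "0\<^sub>v (m j)"] by (simp add: wprod_def)
  have "hess_form (single i v) = (\<Sum>j\<in>{1..N}. if j \<in> cn i then wprod j (A j i *\<^sub>v v) (A j i *\<^sub>v v) else 0)"
    unfolding hess_form_def
    by (rule sum.cong[OF refl]) (use predict_single[OF _ i v] cn_sym[of i] z in auto)
  also have "\<dots> = (\<Sum>j\<in>{1..N} \<inter> cn i. wprod j (A j i *\<^sub>v v) (A j i *\<^sub>v v))"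
    by (simp flip: sum.inter_restrict)
  also have "{1..N} \<inter> cn i = cn i" using cn_subset[OF i] by blast
  finally show ?thesis by (simp add: scalar_prod_hess_block[OF i v v])
qed

lemma hess_block_coercive:
  assumes c: "\<And>e. block_state e \<Longrightarrow> c * (\<Sum>i\<in>{1..N}. e i \<bullet> e i) \<le> hess_form e"
    and i: "i \<in> {1..N}" and v: "v \<in> carrier_vec (n i)"
  shows "c * (v \<bullet> v) \<le> v \<bullet> (hess_block i *\<^sub>v v)"
proof -
  have "(\<Sum>k\<in>{1..N}. single i v k \<bullet> single i v k) = (\<Sum>k\<in>{1..N}. if k = i then v \<bullet> v else 0)"
    by (rule sum.cong[OF refl]) (auto simp: single_def)
  also have "\<dots> = v \<bullet> v" using i by (simp add: sum.delta)
  finally show ?thesis using c[OF single_block[OF i v]] hess_form_single[OF i v] by simp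
qed

section \<open>Descent of the energy under delays\<close>

definition hess_block_inv :: "nat \<Rightarrow> real mat" where
  "hess_block_inv i = the (mat_inverse (hess_block i))"

definition coercive_const :: "real \<Rightarrow> bool" where
  "coercive_const c \<longleftrightarrow> 0 < c \<and> (\<forall>e. block_state e \<longrightarrow> c * (\<Sum>i\<in>{1..N}. e i \<bullet> e i) \<le> hess_form e)"

lemma hess_block_inv_props:
  assumes c: "coercive_const c" and i: "i \<in> {1..N}" and w: "w \<in> carrier_vec (n i)"
  shows "hess_block_inv i *\<^sub>v w \<in> carrier_vec (n i)" "hess_block i *\<^sub>v (hess_block_inv i *\<^sub>v w) = w"
    "vnorm (hess_block_inv i *\<^sub>v w) \<le> vnorm w / c"
proof -
  have c0: "0 < c" using c by (simp add: coercive_const_def)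
  have "c * (v \<bullet> v) \<le> v \<bullet> (hess_block i *\<^sub>v v)" if "v \<in> carrier_vec (n i)" for v
    using hess_block_coercive[OF _ i that] c by (simp add: coercive_const_def)
  then obtain B where B: "mat_inverse (hess_block i) = Some B" "B \<in> carrier_mat (n i) (n i)"
    "hess_block i * B = 1\<^sub>m (n i)" "\<And>w. w \<in> carrier_vec (n i) \<Longrightarrow> vnorm (B *\<^sub>v w) \<le> vnorm w / c"
    using mat_inverse_of_coercive[OF hess_block_carrier[OF i] c0] by blast
  have Di: "hess_block_inv i = B" by (simp add: hess_block_inv_def B)
  show "hess_block_inv i *\<^sub>v w \<in> carrier_vec (n i)" using B(2) w by (simp add: Di)
  show "vnorm (hess_block_inv i *\<^sub>v w) \<le> vnorm w / c" using B(4) w by (simp add: Di)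
  have "(hess_block i * B) *\<^sub>v w = hess_block i *\<^sub>v (B *\<^sub>v w)"
    by (rule assoc_mult_mat_vec[OF hess_block_carrier[OF i] B(2) w])
  then show "hess_block i *\<^sub>v (hess_block_inv i *\<^sub>v w) = w" using w by (simp add: Di B(3))
qed

text \<open>The squared norm \<open>e . D e\<close>, with \<open>D\<close> the block diagonal of \<open>H\<close>. The matrix \<open>D^-1 H\<close> is
  self-adjoint and positive for this inner product, which makes it the natural Lyapunov
  function of the iteration.\<close>

definition energy :: "state \<Rightarrow> real" where
  "energy e = (\<Sum>i\<in>{1..N}. e i \<bullet> (hess_block i *\<^sub>v e i))"

lemma energy_lower:
  assumes "coercive_const c" "block_state e"
  shows "c * (\<Sum>i\<in>{1..N}. e i \<bullet> e i) \<le> energy e"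
  unfolding energy_def sum_distrib_left
  by (rule sum_mono) (use assms hess_block_coercive block_stateD in \<open>auto simp: coercive_const_def\<close>)

lemma energy_nonneg:
  assumes "coercive_const c" "block_state e"
  shows "0 \<le> energy e"
  using energy_lower[OF assms] assms(1)
  by (smt (verit) coercive_const_def mult_nonneg_nonneg scalar_prod_self_nonneg sum_nonneg)

definition hess_block_bound :: real where
  "hess_block_bound = 1 + (\<Sum>i\<in>{1..N}. op_bound (hess_block i))"

lemma hess_block_bound_pos: "0 < hess_block_bound"
  unfolding hess_block_bound_def by (simp add: add_pos_nonneg sum_nonneg)

lemma energy_upper:
  assumes "block_state e"
  shows "energy e \<le> hess_block_bound * (\<Sum>i\<in>{1..N}. e i \<bullet> e i)"
  unfolding energy_def sum_distrib_left
proof (rule sum_mono)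
  fix i assume i: "i \<in> {1..N}"
  note e = block_stateD[OF assms i]
  have "e i \<bullet> (hess_block i *\<^sub>v e i) \<le> vnorm (e i) * vnorm (hess_block i *\<^sub>v e i)"
    using abs_scalar_prod_le[OF e mult_mat_vec_carrier[OF hess_block_carrier[OF i] e]] by linarith
  also have "\<dots> \<le> vnorm (e i) * (op_bound (hess_block i) * vnorm (e i))"
    by (intro mult_left_mono vnorm_mult_mat_vec_le[OF hess_block_carrier[OF i] e]) simp
  also have "\<dots> = op_bound (hess_block i) * (e i \<bullet> e i)"
    by (simp add: power2_eq_square flip: vnorm_square)
  also have "\<dots> \<le> hess_block_bound * (e i \<bullet> e i)"
  proof (rule mult_right_mono[OF _ scalar_prod_self_nonneg])
    have "op_bound (hess_block i) \<le> (\<Sum>i\<in>{1..N}. op_bound (hess_block i))"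
      by (rule member_le_sum) (use i in auto)
    then show "op_bound (hess_block i) \<le> hess_block_bound" by (simp add: hess_block_bound_def)
  qed
  finally show "e i \<bullet> (hess_block i *\<^sub>v e i) \<le> hess_block_bound * (e i \<bullet> e i)" .
qed

lemma energy_cong: "(\<And>i. i \<in> {1..N} \<Longrightarrow> e i = e' i) \<Longrightarrow> energy e = energy e'"
  unfolding energy_def by (rule sum.cong) auto

lemma hess_form_eq_backproject:
  assumes "block_state e"
  shows "hess_form e = (\<Sum>i\<in>{1..N}. e i \<bullet> backproject i (\<lambda>j. predict j e))"
  unfolding hess_form_def
  by (rule sum_scalar_prod_backproject[symmetric]) (use assms predict_carrier in auto)

text \<open>With \<open>p\<close> the perturbed gradient and \<open>u = D^-1 p\<close>, the energy of \<open>e - \<epsilon> u\<close> is \<open>energy e - 2 \<epsilon>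
  (e . p) + \<epsilon>^2 (u . p)\<close>. The cross term is the Hessian form up to a multiple of the error \<open>\<delta>\<close>
  of the arguments \<open>d i j\<close> in place of \<open>e\<close>, and \<open>u . p\<close> is bounded by the size of the
  arguments. Agents need not agree on the arguments, hence the two indices of \<open>d\<close>.\<close>

lemma descent:
  assumes c: "coercive_const c" and e: "block_state e" and \<epsilon>: "0 < \<epsilon>"
    and d: "\<And>i j. i \<in> {1..N} \<Longrightarrow> j \<in> cn i \<Longrightarrow> block_state (d i j)"
    and b: "0 \<le> b" "0 \<le> \<delta>" "\<And>k. k \<in> {1..N} \<Longrightarrow> vnorm (e k) \<le> b"
    and db: "\<And>i j k. i \<in> {1..N} \<Longrightarrow> j \<in> cn i \<Longrightarrow> k \<in> cn j \<Longrightarrow> vnorm (d i j k) \<le> b"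
    and dd: "\<And>i j k. i \<in> {1..N} \<Longrightarrow> j \<in> cn i \<Longrightarrow> k \<in> cn j \<Longrightarrow> vnorm (d i j k - e k) \<le> \<delta>"
  shows "energy (\<lambda>i. e i - \<epsilon> \<cdot>\<^sub>v (hess_block_inv i *\<^sub>v backproject i (\<lambda>j. predict j (d i j))))
    \<le> energy e - 2 * \<epsilon> * hess_form e + 2 * \<epsilon> * (N * (b * (backproject_bound * \<delta>)))
      + \<epsilon>\<^sup>2 * (N * ((backproject_bound * b)\<^sup>2 / c))"
proof -
  have c0: "0 < c" using c by (simp add: coercive_const_def)
  define p where "p i = backproject i (\<lambda>j. predict j (d i j))" for i
  define u where "u i = hess_block_inv i *\<^sub>v p i" for i
  have prc: "predict j (d i j) \<in> carrier_vec (m j)" if "i \<in> {1..N}" "j \<in> cn i" for i j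
    using predict_carrier[OF cn_vertex[OF that] d[OF that]] .
  have prec: "predict j e \<in> carrier_vec (m j)" if "i \<in> {1..N}" "j \<in> cn i" for i j
    using predict_carrier[OF cn_vertex[OF that] e] .
  have pc: "p i \<in> carrier_vec (n i)" if "i \<in> {1..N}" for i
    unfolding p_def by (rule backproject_carrier[OF that prc[OF that]])
  have uc: "u i \<in> carrier_vec (n i)" and Du: "hess_block i *\<^sub>v u i = p i" and
    un: "vnorm (u i) \<le> vnorm (p i) / c" if "i \<in> {1..N}" for i
    unfolding u_def using hess_block_inv_props[OF c that pc[OF that]] by auto
  have pn: "vnorm (p i) \<le> backproject_bound * b" if "i \<in> {1..N}" for i
    unfolding p_def by (rule vnorm_backproject_predict_le) (use that d db b in auto)
  have expand: "(e i - \<epsilon> \<cdot>\<^sub>v u i) \<bullet> (hess_block i *\<^sub>v (e i - \<epsilon> \<cdot>\<^sub>v u i))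
      = e i \<bullet> (hess_block i *\<^sub>v e i) - 2 * \<epsilon> * (e i \<bullet> p i) + \<epsilon>\<^sup>2 * (u i \<bullet> p i)" if i: "i \<in> {1..N}" for i
  proof -
    note ec = block_stateD[OF e i] and uc = uc[OF i] and Dc = hess_block_carrier[OF i] and pc = pc[OF i]
    have De: "hess_block i *\<^sub>v e i \<in> carrier_vec (n i)" using Dc ec by (rule mult_mat_vec_carrier)
    have "hess_block i *\<^sub>v (e i - \<epsilon> \<cdot>\<^sub>v u i) = hess_block i *\<^sub>v e i - \<epsilon> \<cdot>\<^sub>v p i"
      using mult_minus_distrib_mat_vec[OF Dc ec smult_carrier_vec[THEN iffD2, OF uc, of \<epsilon>]]
        mult_mat_vec[OF Dc uc, of \<epsilon>] Du[OF i] by simp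
    moreover have "u i \<bullet> (hess_block i *\<^sub>v e i) = e i \<bullet> p i" using hess_block_sym[OF i uc ec] Du[OF i] by simp
    ultimately show ?thesis
      using ec uc pc De
      by (simp add: minus_scalar_prod_distrib[of _ "n i"] scalar_prod_minus_distrib[of _ "n i"]
          power2_eq_square algebra_simps)
  qed
  have cross: "e i \<bullet> backproject i (\<lambda>j. predict j e) - b * (backproject_bound * \<delta>) \<le> e i \<bullet> p i"
    if i: "i \<in> {1..N}" for i
  proof -
    note ec = block_stateD[OF e i]
    define h where "h = backproject i (\<lambda>j. predict j e)"
    have hc: "h \<in> carrier_vec (n i)"
      unfolding h_def by (rule backproject_carrier[OF i prec[OF i]])
    have "p i - h = backproject i (\<lambda>j. predict j (d i j) - predict j e)"
      unfolding p_def h_def by (rule backproject_minus[OF i prc[OF i] prec[OF i], symmetric])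
    also have "\<dots> = backproject i (\<lambda>j. predict j (\<lambda>k. d i j k - e k))"
      unfolding backproject_def
    proof (rule finsum_vec_cong[OF finite_cn[OF i]])
      fix j assume j: "j \<in> cn i"
      show "(transpose_mat (A j i) * W j) *\<^sub>v (predict j (d i j) - predict j e) =
         (transpose_mat (A j i) * W j) *\<^sub>v predict j (\<lambda>k. d i j k - e k)"
        using predict_minus[OF cn_vertex[OF i j] d[OF i j] e] by simp
      show "(transpose_mat (A j i) * W j) *\<^sub>v (predict j (d i j) - predict j e) \<in> carrier_vec (n i)"
        by (rule backproject_terms[OF i j minus_carrier_vec[OF prc[OF i j] prec[OF i j]]])
    qed
    also have "vnorm \<dots> \<le> backproject_bound * \<delta>"
      by (rule vnorm_backproject_predict_le[OF i block_state_minus[OF d[OF i] e] dd[OF i] b(2)])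
    finally have hn: "vnorm (p i - h) \<le> backproject_bound * \<delta>" .
    have "\<bar>e i \<bullet> (p i - h)\<bar> \<le> vnorm (e i) * vnorm (p i - h)"
      by (rule abs_scalar_prod_le[OF ec minus_carrier_vec[OF pc[OF i] hc]])
    also have "\<dots> \<le> b * (backproject_bound * \<delta>)"
      by (rule mult_mono[OF b(3)[OF i] hn b(1)]) simp
    finally show ?thesis
      using scalar_prod_minus_distrib[OF ec pc[OF i] hc] unfolding h_def by linarith
  qed
  have curv: "u i \<bullet> p i \<le> (backproject_bound * b)\<^sup>2 / c" if i: "i \<in> {1..N}" for i
  proof -
    have "u i \<bullet> p i \<le> vnorm (u i) * vnorm (p i)"
      using abs_scalar_prod_le[OF uc[OF i] pc[OF i]] by linarith
    also have "\<dots> \<le> (vnorm (p i) / c) * vnorm (p i)"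
      by (rule mult_right_mono[OF un[OF i]]) simp
    also have "\<dots> = (vnorm (p i))\<^sup>2 / c" by (simp add: power2_eq_square)
    also have "\<dots> \<le> (backproject_bound * b)\<^sup>2 / c"
      using pn[OF i] c0 by (intro divide_right_mono power_mono) auto
    finally show ?thesis .
  qed
  have "energy (\<lambda>i. e i - \<epsilon> \<cdot>\<^sub>v u i)
     = (\<Sum>i\<in>{1..N}. e i \<bullet> (hess_block i *\<^sub>v e i) - 2 * \<epsilon> * (e i \<bullet> p i) + \<epsilon>\<^sup>2 * (u i \<bullet> p i))"
    unfolding energy_def by (rule sum.cong[OF refl expand])
  also have "\<dots> \<le> (\<Sum>i\<in>{1..N}. e i \<bullet> (hess_block i *\<^sub>v e i)
      - 2 * \<epsilon> * (e i \<bullet> backproject i (\<lambda>j. predict j e) - b * (backproject_bound * \<delta>))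
      + \<epsilon>\<^sup>2 * ((backproject_bound * b)\<^sup>2 / c))"
    using \<epsilon> by (intro sum_mono add_mono diff_mono mult_left_mono cross curv) auto
  also have "\<dots> = energy e - 2 * \<epsilon> * hess_form e + 2 * \<epsilon> * (N * (b * (backproject_bound * \<delta>)))
      + \<epsilon>\<^sup>2 * (N * ((backproject_bound * b)\<^sup>2 / c))"
    unfolding energy_def hess_form_eq_backproject[OF e] right_diff_distrib sum.distrib sum_subtractf
      sum_distrib_left[symmetric] sum_constant card_atLeastAtMost
    by (simp add: algebra_simps)
  finally show ?thesis unfolding u_def p_def .
qed

text \<open>The error recursion after start-up: the delay depends on the agent \<open>i\<close>, on the residual \<open>j\<close>
  and on the block \<open>k\<close> in it, and varies arbitrarily with time.\<close>

definition delayed_descent :: "nat \<Rightarrow> real \<Rightarrow> (nat \<Rightarrow> state) \<Rightarrow> bool" where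
  "delayed_descent L \<epsilon> e \<longleftrightarrow> (\<forall>t. block_state (e t)) \<and>
     (\<forall>t\<ge>L. \<forall>i\<in>{1..N}. \<exists>\<tau>. (\<forall>j k. t - L \<le> \<tau> j k \<and> \<tau> j k \<le> t) \<and>
        e (Suc t) i = e t i - \<epsilon> \<cdot>\<^sub>v (hess_block_inv i *\<^sub>v backproject i (\<lambda>j. predict j (\<lambda>k. e (\<tau> j k) k))))"

lemma delayed_block_state: "(\<And>t. block_state (e t)) \<Longrightarrow> block_state (\<lambda>k. e (\<tau> k) k)"
  by (simp add: block_state_def)

text \<open>Each of the \<open>h\<close> steps between \<open>t - h\<close> and \<open>t\<close> moves block \<open>k\<close> by at most a constant times \<open>\<epsilon>\<close>
  times the size of the errors that it reads. These lie up to \<open>L\<close> steps before the step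
  itself, which is why errors have to be controlled on a window of length \<open>2 L\<close>.\<close>

lemma delayed_descent_drift:
  assumes c: "coercive_const c" and dyn: "delayed_descent L \<epsilon> e" and \<epsilon>: "0 < \<epsilon>"
    and t: "2 * L \<le> t" and b0: "0 \<le> b"
    and b: "\<And>s k. t - 2 * L \<le> s \<Longrightarrow> s \<le> t \<Longrightarrow> k \<in> {1..N} \<Longrightarrow> vnorm (e s k) \<le> b"
    and k: "k \<in> {1..N}" and h: "h \<le> L"
  shows "vnorm (e (t - h) k - e t k) \<le> real h * (\<epsilon> * (backproject_bound * b / c))"
  using h
proof (induction h)
  case 0
  have "e t k - e t k = 0\<^sub>v (n k)"
    using dyn block_stateD[OF _ k] by (auto simp: delayed_descent_def intro!: eq_vecI)
  then show ?case by simp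
next
  case (Suc h)
  \<comment> \<open>Going back from \<open>t - h\<close> adds the single step from \<open>s\<close> to \<open>s + 1 = t - h\<close>.\<close>
  define s where "s = t - Suc h"
  have s: "Suc s = t - h" "L \<le> s" "t - 2 * L \<le> s - L" "s \<le> t"
    using Suc.prems t by (auto simp: s_def)
  have bs: "\<And>t. block_state (e t)" using dyn by (simp add: delayed_descent_def)
  have ec: "e r k \<in> carrier_vec (n k)" for r by (rule block_stateD[OF bs k])
  obtain \<tau> where \<tau>: "\<And>j k. s - L \<le> \<tau> j k \<and> \<tau> j k \<le> s"
    "e (Suc s) k = e s k - \<epsilon> \<cdot>\<^sub>v (hess_block_inv k *\<^sub>v backproject k (\<lambda>j. predict j (\<lambda>l. e (\<tau> j l) l)))"
    using dyn[unfolded delayed_descent_def, THEN conjunct2, rule_format, OF s(2) k] by blast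
  define p where "p = backproject k (\<lambda>j. predict j (\<lambda>l. e (\<tau> j l) l))"
  define u where "u = hess_block_inv k *\<^sub>v p"
  have pn: "vnorm p \<le> backproject_bound * b"
    unfolding p_def
  proof (rule vnorm_backproject_predict_le[OF k delayed_block_state[OF bs] _ b0])
    fix j l assume jl: "j \<in> cn k" "l \<in> cn j"
    then have "l \<in> {1..N}" using cn_vertex k by blast
    then show "vnorm (e (\<tau> j l) l) \<le> b"
      using \<tau>(1)[of j l] s by (intro b) auto
  qed
  have pc: "p \<in> carrier_vec (n k)"
    unfolding p_def
    by (rule backproject_carrier[OF k predict_carrier[OF cn_vertex[OF k] delayed_block_state[OF bs]]])
  have uc: "u \<in> carrier_vec (n k)" unfolding u_def by (rule hess_block_inv_props(1)[OF c k pc])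
  have c0: "0 < c" using c by (simp add: coercive_const_def)
  have "vnorm u \<le> vnorm p / c" unfolding u_def by (rule hess_block_inv_props(3)[OF c k pc])
  also have "\<dots> \<le> backproject_bound * b / c" using pn c0 by (simp add: divide_right_mono)
  finally have un: "vnorm u \<le> backproject_bound * b / c" .
  have es: "e (Suc s) k = e s k - \<epsilon> \<cdot>\<^sub>v u" using \<tau>(2) by (simp add: u_def p_def)
  have "e s k - e t k = (e (Suc s) k - e t k) + \<epsilon> \<cdot>\<^sub>v u"
    unfolding es using ec[of s] ec[of t] uc by (intro eq_vecI) auto
  then have "vnorm (e s k - e t k) \<le> vnorm (e (Suc s) k - e t k) + vnorm (\<epsilon> \<cdot>\<^sub>v u)"
    using vnorm_add_le[of "e (Suc s) k - e t k" "n k" "\<epsilon> \<cdot>\<^sub>v u"] ec uc by simp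
  also have "\<dots> \<le> real h * (\<epsilon> * (backproject_bound * b / c)) + \<epsilon> * (backproject_bound * b / c)"
  proof (rule add_mono)
    show "vnorm (e (Suc s) k - e t k) \<le> real h * (\<epsilon> * (backproject_bound * b / c))"
      unfolding s(1) using Suc.IH Suc.prems by simp
    have "\<epsilon> * vnorm u \<le> \<epsilon> * (backproject_bound * b / c)" using un \<epsilon> by (intro mult_left_mono) auto
    then show "vnorm (\<epsilon> \<cdot>\<^sub>v u) \<le> \<epsilon> * (backproject_bound * b / c)"
      using \<epsilon> by (simp add: vnorm_smult)
  qed
  finally show ?case
    unfolding s_def of_nat_Suc by (simp only: distrib_right mult_1_left add.commute)
qed

lemma vnorm_le_energy:
  assumes c: "coercive_const c" and e: "block_state e" and energy: "energy e \<le> \<beta>" and k: "k \<in> {1..N}"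
  shows "vnorm (e k) \<le> sqrt (\<beta> / c)"
proof (rule real_le_rsqrt)
  have c0: "0 < c" using c by (simp add: coercive_const_def)
  have "e k \<bullet> e k \<le> (\<Sum>i\<in>{1..N}. e i \<bullet> e i)"
    by (rule member_le_sum) (use k in \<open>auto simp: scalar_prod_self_nonneg\<close>)
  then have "c * (e k \<bullet> e k) \<le> c * (\<Sum>i\<in>{1..N}. e i \<bullet> e i)" using c0 by simp
  also have "\<dots> \<le> \<beta>" using energy_lower[OF c e] energy by linarith
  finally show "(vnorm (e k))\<^sup>2 \<le> \<beta> / c" using c0 by (simp add: vnorm_square field_simps)
qed

text \<open>The coefficient of \<open>\<epsilon>^2\<close> times the largest energy in the window. The summand \<open>2 L\<close> comes from
  the drift over the delay, the summand \<open>1\<close> from the length of the step itself.\<close>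

definition drift_const :: "nat \<Rightarrow> real \<Rightarrow> real" where
  "drift_const L c = real N * backproject_bound\<^sup>2 * (2 * L + 1) / c\<^sup>2"

text \<open>Half of the first order decrease \<open>2 \<epsilon> a energy\<close>, where \<open>a = c / hess_block_bound\<close>, is given up
  to compensate the second order terms; this is the second bound on \<open>\<epsilon>\<close>. The first one keeps
  the coefficient of the current energy nonnegative, so that it may be replaced by its bound
  \<open>\<beta>\<close>.\<close>

lemma delayed_descent_contraction:
  assumes c: "coercive_const c" and dyn: "delayed_descent L \<epsilon> e" and \<epsilon>: "0 < \<epsilon>"
    and \<epsilon>1: "2 * \<epsilon> * (c / hess_block_bound) \<le> 1" and \<epsilon>2: "\<epsilon> * drift_const L c \<le> c / hess_block_bound"
    and t: "2 * L \<le> t"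
    and \<beta>: "\<And>s. t - 2 * L \<le> s \<Longrightarrow> s \<le> t \<Longrightarrow> energy (e s) \<le> \<beta>"
  shows "energy (e (Suc t)) \<le> (1 - \<epsilon> * (c / hess_block_bound)) * \<beta>"
proof -
  have c0: "0 < c" using c by (simp add: coercive_const_def)
  have bs: "\<And>t. block_state (e t)" using dyn by (simp add: delayed_descent_def)
  have \<beta>0: "0 \<le> \<beta>" using energy_nonneg[OF c bs, of t] \<beta>[of t] by simp
  define b where "b = sqrt (\<beta> / c)"
  have b0: "0 \<le> b" and b2: "b\<^sup>2 = \<beta> / c" using \<beta>0 c0 by (auto simp: b_def)
  have b: "vnorm (e s k) \<le> b" if "t - 2 * L \<le> s" "s \<le> t" "k \<in> {1..N}" for s k
    unfolding b_def by (rule vnorm_le_energy[OF c bs \<beta>[OF that(1,2)] that(3)])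
  define \<delta> where "\<delta> = real L * (\<epsilon> * (backproject_bound * b / c))"
  have drift0: "0 \<le> \<epsilon> * (backproject_bound * b / c)"
    using \<epsilon> backproject_bound_nonneg b0 c0 by simp
  have \<delta>0: "0 \<le> \<delta>" unfolding \<delta>_def by (rule mult_nonneg_nonneg[OF _ drift0]) simp
  have drift: "vnorm (e s k - e t k) \<le> \<delta>" if "t - L \<le> s" "s \<le> t" "k \<in> {1..N}" for s k
  proof -
    have "vnorm (e (t - (t - s)) k - e t k) \<le> real (t - s) * (\<epsilon> * (backproject_bound * b / c))"
      by (rule delayed_descent_drift[OF c dyn \<epsilon> t b0 b that(3)]) (use that in auto)
    also have "\<dots> \<le> \<delta>"
      unfolding \<delta>_def by (rule mult_right_mono[OF _ drift0]) (use that in auto)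
    finally show ?thesis using that by simp
  qed
  have "\<forall>i\<in>{1..N}. \<exists>\<tau>. (\<forall>j k. t - L \<le> \<tau> j k \<and> \<tau> j k \<le> t) \<and>
        e (Suc t) i = e t i - \<epsilon> \<cdot>\<^sub>v (hess_block_inv i *\<^sub>v backproject i (\<lambda>j. predict j (\<lambda>k. e (\<tau> j k) k)))"
    using dyn t unfolding delayed_descent_def by simp
  from bchoice[OF this] obtain \<tau> where \<tau>: "\<And>i j k. i \<in> {1..N} \<Longrightarrow> t - L \<le> \<tau> i j k \<and> \<tau> i j k \<le> t"
    and step: "\<And>i. i \<in> {1..N} \<Longrightarrow> e (Suc t) i
      = e t i - \<epsilon> \<cdot>\<^sub>v (hess_block_inv i *\<^sub>v backproject i (\<lambda>j. predict j (\<lambda>k. e (\<tau> i j k) k)))"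
    by blast
  have "energy (e (Suc t)) = energy (\<lambda>i. e t i - \<epsilon> \<cdot>\<^sub>v
      (hess_block_inv i *\<^sub>v backproject i (\<lambda>j. predict j (\<lambda>k. e (\<tau> i j k) k))))"
    by (rule energy_cong[OF step])
  also have "\<dots> \<le> energy (e t) - 2 * \<epsilon> * hess_form (e t) + 2 * \<epsilon> * (N * (b * (backproject_bound * \<delta>)))
      + \<epsilon>\<^sup>2 * (N * ((backproject_bound * b)\<^sup>2 / c))"
  proof (rule descent[OF c bs \<epsilon> delayed_block_state[OF bs] b0 \<delta>0])
    fix k assume "k \<in> {1..N}" then show "vnorm (e t k) \<le> b" by (intro b) auto
  next
    fix i j k assume ijk: "i \<in> {1..N}" "j \<in> cn i" "k \<in> cn j"
    then have k: "k \<in> {1..N}" using cn_vertex by blast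
    show "vnorm (e (\<tau> i j k) k) \<le> b" using \<tau>[OF ijk(1), of j k] k by (intro b) auto
    show "vnorm (e (\<tau> i j k) k - e t k) \<le> \<delta>" using \<tau>[OF ijk(1), of j k] k by (intro drift) auto
  qed
  also have "\<dots> = energy (e t) - 2 * \<epsilon> * hess_form (e t) + \<epsilon>\<^sup>2 * (N * backproject_bound\<^sup>2 * (2 * L + 1) / c * b\<^sup>2)"
    using c0 by (simp add: \<delta>_def power2_eq_square field_simps)
  also have "\<dots> = energy (e t) - 2 * \<epsilon> * hess_form (e t) + \<epsilon> * (\<epsilon> * drift_const L c) * \<beta>"
    unfolding b2 drift_const_def by (simp add: power2_eq_square)
  also have "\<dots> \<le> energy (e t) - 2 * \<epsilon> * (c / hess_block_bound * energy (e t)) + \<epsilon> * (c / hess_block_bound) * \<beta>"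
  proof -
    have "c / hess_block_bound * energy (e t) \<le> c / hess_block_bound * (hess_block_bound * (\<Sum>i\<in>{1..N}. e t i \<bullet> e t i))"
      using energy_upper[OF bs] c0 hess_block_bound_pos by (intro mult_left_mono) auto
    also have "\<dots> \<le> hess_form (e t)"
      using c bs hess_block_bound_pos by (simp add: coercive_const_def)
    finally have "\<epsilon> * (c / hess_block_bound * energy (e t)) \<le> \<epsilon> * hess_form (e t)"
      by (rule mult_left_mono) (use \<epsilon> in simp)
    moreover have "\<epsilon> * (\<epsilon> * drift_const L c) * \<beta> \<le> \<epsilon> * (c / hess_block_bound) * \<beta>"
      using \<epsilon> \<epsilon>2 \<beta>0 by (intro mult_right_mono mult_left_mono) auto
    ultimately show ?thesis by linarith
  qed
  also have "\<dots> = (1 - 2 * \<epsilon> * (c / hess_block_bound)) * energy (e t) + \<epsilon> * (c / hess_block_bound) * \<beta>"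
    by (simp add: algebra_simps)
  also have "\<dots> \<le> (1 - 2 * \<epsilon> * (c / hess_block_bound)) * \<beta> + \<epsilon> * (c / hess_block_bound) * \<beta>"
    using \<epsilon>1 \<beta>[of t] by (intro add_right_mono mult_left_mono) auto
  also have "\<dots> = (1 - \<epsilon> * (c / hess_block_bound)) * \<beta>" by (simp add: algebra_simps)
  finally show ?thesis .
qed

lemma delayed_descent_decay:
  assumes c: "coercive_const c"
  shows "\<exists>\<epsilon>b>0. \<forall>\<epsilon> e. 0 < \<epsilon> \<and> \<epsilon> < \<epsilon>b \<and> delayed_descent L \<epsilon> e \<longrightarrow>
    (\<exists>C>0. \<exists>\<rho>. 0 < \<rho> \<and> \<rho> < 1 \<and> (\<forall>t. state_norm N (e t) \<le> C * \<rho> ^ t))"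
proof -
  have c0: "0 < c" using c by (simp add: coercive_const_def)
  define a where "a = c / hess_block_bound"
  have a: "0 < a" using c0 hess_block_bound_pos by (simp add: a_def)
  have M: "0 \<le> drift_const L c" using c0 by (simp add: drift_const_def)
  \<comment> \<open>The summand \<open>1\<close> avoids a division by zero.\<close>
  define \<epsilon>b where "\<epsilon>b = min (1 / (2 * a)) (a / (drift_const L c + 1))"
  have "0 < \<epsilon>b" using a M by (simp add: \<epsilon>b_def)
  moreover have "\<exists>C>0. \<exists>\<rho>. 0 < \<rho> \<and> \<rho> < 1 \<and> (\<forall>t. state_norm N (e t) \<le> C * \<rho> ^ t)"
    if \<epsilon>: "0 < \<epsilon>" "\<epsilon> < \<epsilon>b" and dyn: "delayed_descent L \<epsilon> e" for \<epsilon> e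
  proof -
    have bs: "\<And>t. block_state (e t)" using dyn by (simp add: delayed_descent_def)
    have \<epsilon>1: "2 * \<epsilon> * a < 1" using \<epsilon> a by (simp add: \<epsilon>b_def field_simps)
    have "\<epsilon> * (drift_const L c + 1) < a" using \<epsilon> M by (simp add: \<epsilon>b_def field_simps)
    then have \<epsilon>2: "\<epsilon> * drift_const L c \<le> a" using \<epsilon> by (simp add: algebra_simps)
    have "0 < \<epsilon> * a" using \<epsilon> a by simp
    then have q: "0 < 1 - \<epsilon> * a" "1 - \<epsilon> * a < 1" using \<epsilon>1 by auto
    have "energy (e (Suc t)) \<le> (1 - \<epsilon> * a) * \<beta>"
      if "2 * L \<le> t" "\<And>s. t - 2 * L \<le> s \<Longrightarrow> s \<le> t \<Longrightarrow> energy (e s) \<le> \<beta>" for t \<beta>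
      unfolding a_def
      by (rule delayed_descent_contraction[OF c dyn \<epsilon>(1) _ _ that])
         (use \<epsilon>1 \<epsilon>2 in \<open>auto simp: a_def\<close>)
    then obtain C \<rho> where C: "0 < C" "0 < \<rho>" "\<rho> < 1" "\<And>t. energy (e t) \<le> C * \<rho> ^ t"
      using delayed_contraction_decay[OF q, of "2 * L" "2 * L" "\<lambda>t. energy (e t)"] by blast
    have "state_norm N (e t) \<le> sqrt (C / c) * sqrt \<rho> ^ t" for t
    proof -
      have "c * (state_norm N (e t))\<^sup>2 \<le> C * \<rho> ^ t"
        using energy_lower[OF c bs, of t] C(4)[of t] by (simp add: state_norm_square)
      then have "(state_norm N (e t))\<^sup>2 \<le> C / c * \<rho> ^ t" using c0 by (simp add: field_simps)
      then have "state_norm N (e t) \<le> sqrt (C / c * \<rho> ^ t)" by (rule real_le_rsqrt)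
      then show ?thesis by (simp only: real_sqrt_mult real_sqrt_power)
    qed
    moreover have "0 < sqrt (C / c)" "0 < sqrt \<rho>" "sqrt \<rho> < 1" using C c0 by auto
    ultimately show ?thesis by blast
  qed
  ultimately show ?thesis by blast
qed

section \<open>From the algorithm to the delayed recursion\<close>

text \<open>The state as agent \<open>i\<close> believes it to be. With the true value as default outside of the
  neighborhood, every block of the view is a past or present value of the trajectory as soon
  as \<open>i\<close> has heard from all its neighbors.\<close>

definition view :: "nat \<Rightarrow> state \<Rightarrow> (nat \<Rightarrow> nat \<Rightarrow> real Matrix.vec) \<Rightarrow> state" where
  "view i x xh = (\<lambda>k. if k \<in> neighbors G i then xh i k else x k)"

lemma cn_insert: "cn i = insert i (neighbors G i)"
  by (simp add: closed_neighbors_def)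

lemma neighbor_cn: "j \<in> neighbors G i \<Longrightarrow> j \<in> cn i"
  by (simp add: closed_neighbors_def)

lemma rho_eq_residual:
  assumes i: "i \<in> {1..N}" and v: "block_state (view i x xh)"
  shows "rho i j x xh = (transpose_mat (A i j) * W i) *\<^sub>v residual (view i x xh) i"
proof -
  let ?f = "\<lambda>k. A i k *\<^sub>v view i x xh k"
  have fin: "finite (neighbors G i)" using finite_cn[OF i] by (simp add: cn_insert)
  have c: "?f k \<in> carrier_vec (m i)" if "k \<in> cn i" for k by (rule predict_terms[OF i v that])
  have "predict i (view i x xh) = ?f i + finsum_vec TYPE(real) (m i) ?f (neighbors G i)"
    unfolding predict_def cn_insert
    by (rule finsum_vec_insert[OF fin not_self_neighbor]) (use c cn_insert in auto)
  also have "finsum_vec TYPE(real) (m i) ?f (neighbors G i)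
      = finsum_vec TYPE(real) (m i) (\<lambda>k. A i k *\<^sub>v xh i k) (neighbors G i)"
    by (rule finsum_vec_cong[OF fin]) (use c[OF neighbor_cn] in \<open>auto simp: view_def\<close>)
  finally show ?thesis
    by (simp add: rho_def residual_def view_def not_self_neighbor)
qed

text \<open>The invariant of the algorithm. Until the first reception from \<open>j\<close>, the stored \<open>xi_hat i j\<close> is
  the identity.\<close>

definition valid_memory :: "rwls_memory \<Rightarrow> bool" where
  "valid_memory s \<longleftrightarrow> block_state (cur s) \<and>
     (\<forall>i\<in>{1..N}. \<forall>j\<in>neighbors G i. x_hat s i j \<in> carrier_vec (n j)
        \<and> rho_hat s i j \<in> carrier_vec (n i) \<and> (xi_hat s i j = xi j i \<or> xi_hat s i j = 1\<^sub>m (n i)))"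

lemma step_fields:
  shows "x_hat (rwls_step \<epsilon> g s) i j = (if g i j = 1 then cur s j else x_hat s i j)"
    and "rho_hat (rwls_step \<epsilon> g s) i j = (if j = i then rho i i (cur s) (x_hat (rwls_step \<epsilon> g s))
      else if g i j = 1 then rho j i (cur s) (x_hat s) else rho_hat s i j)"
    and "xi_hat (rwls_step \<epsilon> g s) i j = (if j = i then xi i i
      else if g i j = 1 then xi j i else xi_hat s i j)"
    and "cur (rwls_step \<epsilon> g s) i = cur s i - \<epsilon> \<cdot>\<^sub>v
      (the (mat_inverse (finsum (ring_mat TYPE(real) (n i) ()) (xi_hat (rwls_step \<epsilon> g s) i) (cn i)))
        *\<^sub>v finsum_vec TYPE(real) (n i) (rho_hat (rwls_step \<epsilon> g s) i) (cn i))"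
  by (simp_all add: rwls_step_def Let_def)

lemma xi_scalar_prod_nonneg:
  assumes i: "i \<in> {1..N}" and j: "j \<in> cn i" and v: "v \<in> carrier_vec (n i)"
  shows "0 \<le> v \<bullet> (xi j i *\<^sub>v v)"
  unfolding scalar_prod_xi[OF i j v v]
  by (rule wprod_nonneg[OF cn_vertex[OF i j] mult_mat_vec_carrier[OF A_col_dim[OF i j] v]])

text \<open>During start-up some summands of the preconditioner may still be identities. If one of them
  is, it makes the sum coercive because the other summands are positive semidefinite;
  otherwise the sum is the Hessian block. So the inverse exists in all cases, and the iterates
  stay in the product space.\<close>

lemma preconditioner_inverse:
  assumes c: "coercive_const c" and i: "i \<in> {1..N}"
    and X: "\<And>j. j \<in> cn i \<Longrightarrow> X j = xi j i \<or> X j = 1\<^sub>m (n i)"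
    and w: "w \<in> carrier_vec (n i)"
  shows "the (mat_inverse (finsum (ring_mat TYPE(real) (n i) ()) X (cn i))) *\<^sub>v w \<in> carrier_vec (n i)"
proof -
  let ?X = "finsum (ring_mat TYPE(real) (n i) ()) X (cn i)"
  have c0: "0 < c" using c by (simp add: coercive_const_def)
  have Xc: "X j \<in> carrier_mat (n i) (n i)" if "j \<in> cn i" for j
    using X[OF that] xi_carrier[OF i that] by auto
  have XC: "?X \<in> carrier_mat (n i) (n i)"
    by (rule finsum_mat_closed_mult(1)[OF finite_cn[OF i] Xc])
  have coercive: "min c 1 * (v \<bullet> v) \<le> v \<bullet> (?X *\<^sub>v v)" if v: "v \<in> carrier_vec (n i)" for v
  proof -
    have eq: "v \<bullet> (?X *\<^sub>v v) = (\<Sum>j\<in>cn i. v \<bullet> (X j *\<^sub>v v))"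
      by (rule scalar_prod_finsum_mat[OF finite_cn[OF i] Xc v v])
    have pos: "0 \<le> v \<bullet> (X j *\<^sub>v v)" if "j \<in> cn i" for j
      using X[OF that] xi_scalar_prod_nonneg[OF i that v] v scalar_prod_self_nonneg[of v] by auto
    show ?thesis
    proof (cases "\<exists>j\<in>cn i. X j = 1\<^sub>m (n i)")
      case True
      then obtain j where j: "j \<in> cn i" "X j = 1\<^sub>m (n i)" by blast
      have "min c 1 * (v \<bullet> v) \<le> 1 * (v \<bullet> v)"
        by (rule mult_right_mono[OF _ scalar_prod_self_nonneg]) simp
      also have "\<dots> = v \<bullet> (X j *\<^sub>v v)" using j(2) v by simp
      also have "\<dots> \<le> (\<Sum>j\<in>cn i. v \<bullet> (X j *\<^sub>v v))"
        by (rule member_le_sum[OF j(1) _ finite_cn[OF i]]) (use pos in blast)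
      finally show ?thesis using eq by simp
    next
      case False
      have "min c 1 * (v \<bullet> v) \<le> c * (v \<bullet> v)"
        by (rule mult_right_mono[OF _ scalar_prod_self_nonneg]) simp
      also have "\<dots> \<le> v \<bullet> (hess_block i *\<^sub>v v)"
        using hess_block_coercive[OF _ i v] c by (simp add: coercive_const_def)
      also have "\<dots> = (\<Sum>j\<in>cn i. v \<bullet> (xi j i *\<^sub>v v))"
        unfolding hess_block_def by (rule scalar_prod_finsum_mat[OF finite_cn[OF i] xi_carrier[OF i] v v])
      also have "\<dots> = (\<Sum>j\<in>cn i. v \<bullet> (X j *\<^sub>v v))"
      proof (rule sum.cong[OF refl])
        fix j assume "j \<in> cn i"
        then have "X j = xi j i" using X False by blast
        then show "v \<bullet> (xi j i *\<^sub>v v) = v \<bullet> (X j *\<^sub>v v)" by simp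
      qed
      finally show ?thesis using eq by simp
    qed
  qed
  have "0 < min c 1" using c0 by simp
  from mat_inverse_of_coercive[OF XC this coercive]
  obtain B where "mat_inverse ?X = Some B" "B \<in> carrier_mat (n i) (n i)" by blast
  then show ?thesis using w by simp
qed

lemma view_block_state:
  assumes "valid_memory s" "i \<in> {1..N}"
  shows "block_state (view i (cur s) (x_hat s))"
  using assms by (auto simp: valid_memory_def block_state_def view_def)

lemma rho_carrier:
  assumes i: "i \<in> {1..N}" and j: "j \<in> cn i" and v: "block_state (view j x xh)"
  shows "rho j i x xh \<in> carrier_vec (n i)"
  unfolding rho_eq_residual[OF cn_vertex[OF i j] v]
  by (rule backproject_terms[OF i j residual_carrier[OF cn_vertex[OF i j] v]])

lemma view_step_block_state:
  assumes s: "valid_memory s" and i: "i \<in> {1..N}"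
  shows "block_state (view i (cur s) (x_hat (rwls_step \<epsilon> g s)))"
  using assms by (auto simp: valid_memory_def block_state_def view_def step_fields(1))

lemma step_rho_hat_carrier:
  assumes s: "valid_memory s" and i: "i \<in> {1..N}" and j: "j \<in> cn i"
  shows "rho_hat (rwls_step \<epsilon> g s) i j \<in> carrier_vec (n i)"
proof -
  consider "j = i" | "j \<noteq> i" "g i j = 1" | "j \<noteq> i" "g i j \<noteq> 1" "j \<in> neighbors G i"
    using j cn_insert by blast
  then show ?thesis
  proof cases
    case 1
    then show ?thesis
      unfolding step_fields(2) using rho_carrier[OF i self_cn view_step_block_state[OF s i]] by simp
  next
    case 2
    then show ?thesis
      unfolding step_fields(2)
      using rho_carrier[OF i j view_block_state[OF s cn_vertex[OF i j]]] by simp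
  next
    case 3
    then show ?thesis
      unfolding step_fields(2) using s i by (simp add: valid_memory_def)
  qed
qed

lemma step_xi_hat:
  assumes s: "valid_memory s" and i: "i \<in> {1..N}" and j: "j \<in> cn i"
  shows "xi_hat (rwls_step \<epsilon> g s) i j = xi j i \<or> xi_hat (rwls_step \<epsilon> g s) i j = 1\<^sub>m (n i)"
  using s i j unfolding step_fields(3) cn_insert valid_memory_def by auto

lemma valid_memory_step:
  assumes c: "coercive_const c" and s: "valid_memory s"
  shows "valid_memory (rwls_step \<epsilon> g s)"
proof -
  have cur: "cur (rwls_step \<epsilon> g s) i \<in> carrier_vec (n i)" if i: "i \<in> {1..N}" for i
    unfolding step_fields(4)
  proof (intro minus_carrier_vec smult_carrier_vec[THEN iffD2])
    show "cur s i \<in> carrier_vec (n i)" using s i by (simp add: valid_memory_def block_state_def)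
    show "the (mat_inverse (finsum (ring_mat TYPE(real) (n i) ()) (xi_hat (rwls_step \<epsilon> g s) i) (cn i)))
        *\<^sub>v finsum_vec TYPE(real) (n i) (rho_hat (rwls_step \<epsilon> g s) i) (cn i) \<in> carrier_vec (n i)"
      by (rule preconditioner_inverse[OF c i step_xi_hat[OF s i]
            finsum_vec_in_carrier[OF step_rho_hat_carrier[OF s i]]])
  qed
  have xh: "x_hat (rwls_step \<epsilon> g s) i j \<in> carrier_vec (n j)"
    if "i \<in> {1..N}" "j \<in> neighbors G i" for i j
    using s that cn_vertex[OF that(1) neighbor_cn[OF that(2)]]
    unfolding step_fields(1) valid_memory_def block_state_def by auto
  show ?thesis
    unfolding valid_memory_def block_state_def
    using cur xh step_rho_hat_carrier[OF s _ neighbor_cn] step_xi_hat[OF s _ neighbor_cn] by blast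
qed

lemma valid_memory_init: "block_state x0 \<Longrightarrow> valid_memory (rwls_init x0)"
  by (simp add: valid_memory_def rwls_init_def)

lemma valid_memory_rwls:
  assumes "coercive_const c" "block_state x0"
  shows "valid_memory (rwls \<epsilon> g x0 t)"
  by (induction t) (use assms valid_memory_init valid_memory_step in auto)

definition persistent :: "nat \<Rightarrow> (nat \<Rightarrow> nat \<Rightarrow> nat \<Rightarrow> nat) \<Rightarrow> bool" where
  "persistent T g \<longleftrightarrow> (\<forall>t. \<forall>i\<in>{1..N}. \<forall>j\<in>neighbors G i. \<exists>s\<in>{t..t+T}. g i j s = 1)"

text \<open>What agent \<open>i\<close> holds for \<open>j\<close> is a coherent snapshot of the time \<open>s\<close> of the last reception. The
  stored \<open>rho_hat\<close> was computed by \<open>j\<close> from the memory before the reception at time \<open>s\<close>, that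
  is with data stamped \<open>s - 1\<close> or earlier.\<close>

lemma stored_since_reception:
  assumes ij: "j \<noteq> i" and g: "g i j t0 = 1" and t: "t0 \<le> t"
  shows "\<exists>s\<ge>t0. s \<le> t \<and>
    x_hat (rwls \<epsilon> g x0 (Suc t)) i j = cur (rwls \<epsilon> g x0 s) j \<and>
    rho_hat (rwls \<epsilon> g x0 (Suc t)) i j = rho j i (cur (rwls \<epsilon> g x0 s)) (x_hat (rwls \<epsilon> g x0 s)) \<and>
    xi_hat (rwls \<epsilon> g x0 (Suc t)) i j = xi j i"
  using t
proof (induction t rule: dec_induct)
  case base
  show ?case by (rule exI[of _ t0]) (use ij g in \<open>simp add: step_fields\<close>)
next
  case (step t)
  have unroll: "rwls \<epsilon> g x0 (Suc (Suc t))
      = rwls_step \<epsilon> (\<lambda>i j. g i j (Suc t)) (rwls \<epsilon> g x0 (Suc t))"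
    by (rule rwls.simps(2))
  show ?case
  proof (cases "g i j (Suc t) = 1")
    case True
    show ?thesis
      by (rule exI[of _ "Suc t"])
         (use ij True step.hyps in \<open>simp add: unroll step_fields del: rwls.simps(2)\<close>)
  next
    case False
    obtain s where "t0 \<le> s" "s \<le> t"
      "x_hat (rwls \<epsilon> g x0 (Suc t)) i j = cur (rwls \<epsilon> g x0 s) j"
      "rho_hat (rwls \<epsilon> g x0 (Suc t)) i j = rho j i (cur (rwls \<epsilon> g x0 s)) (x_hat (rwls \<epsilon> g x0 s))"
      "xi_hat (rwls \<epsilon> g x0 (Suc t)) i j = xi j i"
      using step.IH by blast
    then show ?thesis
      by (intro exI[of _ s])
         (use ij False in \<open>simp add: unroll step_fields del: rwls.simps(2)\<close>)
  qed
qed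

lemma stored_recently:
  assumes pers: "persistent T g" and t: "T \<le> t" and i: "i \<in> {1..N}" and j: "j \<in> neighbors G i"
  shows "\<exists>s\<ge>t - T. s \<le> t \<and>
    x_hat (rwls \<epsilon> g x0 (Suc t)) i j = cur (rwls \<epsilon> g x0 s) j \<and>
    rho_hat (rwls \<epsilon> g x0 (Suc t)) i j = rho j i (cur (rwls \<epsilon> g x0 s)) (x_hat (rwls \<epsilon> g x0 s)) \<and>
    xi_hat (rwls \<epsilon> g x0 (Suc t)) i j = xi j i"
proof -
  have "\<exists>t0\<in>{t - T..t - T + T}. g i j t0 = 1" using pers i j unfolding persistent_def by blast
  then obtain t0 where t0: "t - T \<le> t0" "t0 \<le> t" "g i j t0 = 1" using t by auto
  have ij: "j \<noteq> i" using j not_self_neighbor by blast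
  show ?thesis
    using stored_since_reception[of j i g t0 t \<epsilon> x0, OF ij t0(3,2)] t0(1) order_trans by blast
qed

text \<open>The two cases of \<open>r\<close> are the two ways in which an agent evaluates its residual: for itself
  after the reception at time \<open>t\<close> (\<open>r = t\<close>), and for its neighbors before the reception at
  time \<open>t + 1\<close> (\<open>r = t + 1\<close>).\<close>

lemma view_delayed:
  assumes pers: "persistent T g" and t: "T \<le> t" and i: "i \<in> {1..N}" and r: "r = t \<or> r = Suc t"
  shows "\<exists>\<tau>. (\<forall>k. t - T \<le> \<tau> k \<and> \<tau> k \<le> r) \<and>
    view i (cur (rwls \<epsilon> g x0 r)) (x_hat (rwls \<epsilon> g x0 (Suc t))) = (\<lambda>k. cur (rwls \<epsilon> g x0 (\<tau> k)) k)"
proof -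
  have "\<forall>k. \<exists>s. t - T \<le> s \<and> s \<le> r \<and>
      view i (cur (rwls \<epsilon> g x0 r)) (x_hat (rwls \<epsilon> g x0 (Suc t))) k = cur (rwls \<epsilon> g x0 s) k"
  proof
    fix k
    show "\<exists>s. t - T \<le> s \<and> s \<le> r \<and>
      view i (cur (rwls \<epsilon> g x0 r)) (x_hat (rwls \<epsilon> g x0 (Suc t))) k = cur (rwls \<epsilon> g x0 s) k"
    proof (cases "k \<in> neighbors G i")
      case True
      obtain s where "t - T \<le> s" "s \<le> t" "x_hat (rwls \<epsilon> g x0 (Suc t)) i k = cur (rwls \<epsilon> g x0 s) k"
        using stored_recently[OF pers t i True] by blast
      then show ?thesis using True r by (intro exI[of _ s]) (auto simp only: view_def if_True)
    next
      case False
      then show ?thesis using r by (intro exI[of _ r]) (auto simp: view_def)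
    qed
  qed
  from choice[OF this] show ?thesis by (auto simp: fun_eq_iff)
qed

text \<open>The delays add up: \<open>i\<close> may use a message sent at time \<open>s \<ge> t - T\<close>, whose sender \<open>j\<close> evaluated
  its residual with values that it had received at time \<open>s - 1 - T\<close> or later.\<close>

lemma delayed_update:
  assumes c: "coercive_const c" and x0: "block_state x0" and pers: "persistent T g"
    and t: "2 * T + 1 \<le> t" and i: "i \<in> {1..N}"
  shows "\<exists>\<tau>. (\<forall>j k. t - (2 * T + 1) \<le> \<tau> j k \<and> \<tau> j k \<le> t) \<and>
    cur (rwls \<epsilon> g x0 (Suc t)) i = cur (rwls \<epsilon> g x0 t) i - \<epsilon> \<cdot>\<^sub>v (hess_block_inv i *\<^sub>v
      backproject i (\<lambda>j. residual (\<lambda>k. cur (rwls \<epsilon> g x0 (\<tau> j k)) k) j))"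
proof -
  let ?S = "rwls \<epsilon> g x0"
  have val: "valid_memory (?S s)" for s by (rule valid_memory_rwls[OF c x0])
  have step: "?S (Suc t) = rwls_step \<epsilon> (\<lambda>i j. g i j t) (?S t)" by simp
  have t': "T \<le> t" using t by simp
  have "\<forall>j\<in>cn i. \<exists>\<tau>. (\<forall>k. t - (2 * T + 1) \<le> \<tau> k \<and> \<tau> k \<le> t) \<and>
      rho_hat (?S (Suc t)) i j
        = (transpose_mat (A j i) * W j) *\<^sub>v residual (\<lambda>k. cur (?S (\<tau> k)) k) j"
  proof
    fix j assume j: "j \<in> cn i"
    show "\<exists>\<tau>. (\<forall>k. t - (2 * T + 1) \<le> \<tau> k \<and> \<tau> k \<le> t) \<and>
      rho_hat (?S (Suc t)) i j
        = (transpose_mat (A j i) * W j) *\<^sub>v residual (\<lambda>k. cur (?S (\<tau> k)) k) j"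
    proof (cases "j = i")
      case True
      obtain \<tau> where \<tau>: "\<And>k. t - T \<le> \<tau> k \<and> \<tau> k \<le> t"
        "view i (cur (?S t)) (x_hat (?S (Suc t))) = (\<lambda>k. cur (?S (\<tau> k)) k)"
        using view_delayed[OF pers t' i] by blast
      have "rho_hat (?S (Suc t)) i j = rho i i (cur (?S t)) (x_hat (?S (Suc t)))"
        unfolding step step_fields(2) using True by simp
      also have "\<dots> = (transpose_mat (A i i) * W i) *\<^sub>v residual (\<lambda>k. cur (?S (\<tau> k)) k) i"
        unfolding \<tau>(2)[symmetric] step
        by (rule rho_eq_residual[OF i view_step_block_state[OF val i]])
      finally have "rho_hat (?S (Suc t)) i j
        = (transpose_mat (A j i) * W j) *\<^sub>v residual (\<lambda>k. cur (?S (\<tau> k)) k) j"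
        using True by simp
      moreover have "t - (2 * T + 1) \<le> \<tau> k \<and> \<tau> k \<le> t" for k using \<tau>(1)[of k] by linarith
      ultimately show ?thesis by blast
    next
      case False
      then have nb: "j \<in> neighbors G i" using j cn_insert by blast
      note jN = cn_vertex[OF i j]
      obtain s where s: "t - T \<le> s" "s \<le> t"
        "rho_hat (?S (Suc t)) i j = rho j i (cur (?S s)) (x_hat (?S s))"
        using stored_recently[OF pers t' i nb] by blast
      \<comment> \<open>Here \<open>t \<ge> 2 T + 1\<close> is needed: the sender must itself be past its start-up at time \<open>s\<close>.\<close>
      obtain r where r: "s = Suc r" "T \<le> r" using s(1) t by (cases s) auto
      obtain \<tau> where \<tau>: "\<And>k. r - T \<le> \<tau> k \<and> \<tau> k \<le> s"
        "view j (cur (?S s)) (x_hat (?S s)) = (\<lambda>k. cur (?S (\<tau> k)) k)"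
        using view_delayed[OF pers r(2) jN, of s] r(1) by blast
      have "rho_hat (?S (Suc t)) i j
        = (transpose_mat (A j i) * W j) *\<^sub>v residual (\<lambda>k. cur (?S (\<tau> k)) k) j"
        unfolding s(3) \<tau>(2)[symmetric]
        by (rule rho_eq_residual[OF jN view_block_state[OF val jN]])
      moreover have "t - (2 * T + 1) \<le> \<tau> k \<and> \<tau> k \<le> t" for k using \<tau>(1)[of k] s r by linarith
      ultimately show ?thesis by blast
    qed
  qed
  from bchoice[OF this] obtain \<sigma> where \<sigma>: "\<forall>j\<in>cn i. (\<forall>k. t - (2 * T + 1) \<le> \<sigma> j k \<and> \<sigma> j k \<le> t) \<and>
      rho_hat (?S (Suc t)) i j
        = (transpose_mat (A j i) * W j) *\<^sub>v residual (\<lambda>k. cur (?S (\<sigma> j k)) k) j"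
    by blast
  \<comment> \<open>The value for \<open>j\<close> outside of the neighborhood only serves to satisfy the bounds on \<open>\<tau>\<close>.\<close>
  define \<tau> where "\<tau> j k = (if j \<in> cn i then \<sigma> j k else t)" for j k
  have "finsum_vec TYPE(real) (n i) (rho_hat (?S (Suc t)) i) (cn i)
      = backproject i (\<lambda>j. residual (\<lambda>k. cur (?S (\<tau> j k)) k) j)"
    unfolding backproject_def
  proof (rule finsum_vec_cong[OF finite_cn[OF i]])
    fix j assume j: "j \<in> cn i"
    show "rho_hat (?S (Suc t)) i j
        = (transpose_mat (A j i) * W j) *\<^sub>v residual (\<lambda>k. cur (?S (\<tau> j k)) k) j"
      using \<sigma> j unfolding \<tau>_def by simp
    show "rho_hat (?S (Suc t)) i j \<in> carrier_vec (n i)"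
      unfolding step by (rule step_rho_hat_carrier[OF val i j])
  qed
  moreover have "finsum (ring_mat TYPE(real) (n i) ()) (xi_hat (?S (Suc t)) i) (cn i) = hess_block i"
  proof -
    interpret R: ring "ring_mat TYPE(real) (n i) ()" by (rule ring_mat)
    have "xi_hat (?S (Suc t)) i j = xi j i" if j: "j \<in> cn i" for j
    proof (cases "j = i")
      case True
      then show ?thesis unfolding step step_fields(3) by simp
    next
      case False
      then have "j \<in> neighbors G i" using j cn_insert by blast
      then show ?thesis using stored_recently[OF pers t' i] by blast
    qed
    then show ?thesis
      unfolding hess_block_def
      by (intro R.finsum_cong') (use xi_carrier[OF i] in \<open>auto simp: ring_mat_simps\<close>)
  qed
  moreover have "t - (2 * T + 1) \<le> \<tau> j k \<and> \<tau> j k \<le> t" for j k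
    using \<sigma> by (auto simp: \<tau>_def)
  ultimately show ?thesis
    unfolding hess_block_inv_def using step_fields(4)[of \<epsilon> "\<lambda>i j. g i j t" "?S t" i] unfolding step[symmetric]
    by (intro exI[of _ \<tau>]) simp
qed

text \<open>Subtracting the vanishing gradient at the minimizer turns the residuals of \<open>x\<close> into the
  predictions of the error.\<close>

lemma error_recursion:
  assumes c: "coercive_const c" and min: "unique_minimizer N n J xs"
    and x0: "block_state x0" and pers: "persistent T g"
  shows "delayed_descent (2 * T + 1) \<epsilon> (\<lambda>t i. trajectory \<epsilon> g x0 t i - xs i)"
  unfolding delayed_descent_def
proof (intro conjI allI impI ballI)
  have xs: "block_state xs" using min state_space_block unfolding unique_minimizer_def by blast
  have bs: "block_state (trajectory \<epsilon> g x0 t)" for t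
    using valid_memory_rwls[OF c x0] unfolding trajectory_def valid_memory_def by blast
  show "block_state (\<lambda>i. trajectory \<epsilon> g x0 t i - xs i)" for t by (rule block_state_minus[OF bs xs])
  fix t i assume t: "2 * T + 1 \<le> t" and i: "i \<in> {1..N}"
  obtain \<tau> where \<tau>: "\<And>j k. t - (2 * T + 1) \<le> \<tau> j k \<and> \<tau> j k \<le> t"
    "trajectory \<epsilon> g x0 (Suc t) i = trajectory \<epsilon> g x0 t i - \<epsilon> \<cdot>\<^sub>v (hess_block_inv i *\<^sub>v
      backproject i (\<lambda>j. residual (\<lambda>k. trajectory \<epsilon> g x0 (\<tau> j k) k) j))"
    using delayed_update[OF c x0 pers t i, of \<epsilon>] unfolding trajectory_def by blast
  let ?z = "\<lambda>j k. trajectory \<epsilon> g x0 (\<tau> j k) k"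
  have z: "block_state (?z j)" for j by (rule delayed_block_state[OF bs])
  have rc: "residual (?z j) j \<in> carrier_vec (m j)" "residual xs j \<in> carrier_vec (m j)"
    if "j \<in> cn i" for j
    using residual_carrier[OF cn_vertex[OF i that]] z xs by auto
  define p where "p = backproject i (\<lambda>j. residual (?z j) j)"
  have pc: "p \<in> carrier_vec (n i)" unfolding p_def by (rule backproject_carrier[OF i rc(1)])
  have "p = backproject i (\<lambda>j. residual (?z j) j) - backproject i (residual xs)"
    using pc stationary(2)[OF min i] by (simp add: p_def)
  also have "\<dots> = backproject i (\<lambda>j. residual (?z j) j - residual xs j)"
    by (rule backproject_minus[OF i rc, symmetric])
  also have "\<dots> = backproject i (\<lambda>j. predict j (\<lambda>k. ?z j k - xs k))"
    unfolding backproject_def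
  proof (rule finsum_vec_cong[OF finite_cn[OF i]])
    fix j assume j: "j \<in> cn i"
    note jN = cn_vertex[OF i j]
    have "residual (?z j) j - residual xs j = predict j (?z j) - predict j xs"
      unfolding residual_def
      using predict_carrier[OF jN z, of j] predict_carrier[OF jN xs] y_dim[OF jN]
      by (intro eq_vecI) auto
    then show "(transpose_mat (A j i) * W j) *\<^sub>v (residual (?z j) j - residual xs j) =
       (transpose_mat (A j i) * W j) *\<^sub>v predict j (\<lambda>k. ?z j k - xs k)"
      using predict_minus[OF jN z xs] by simp
    show "(transpose_mat (A j i) * W j) *\<^sub>v (residual (?z j) j - residual xs j) \<in> carrier_vec (n i)"
      by (rule backproject_terms[OF i j minus_carrier_vec[OF rc[OF j]]])
  qed
  finally have p: "p = backproject i (\<lambda>j. predict j (\<lambda>k. ?z j k - xs k))" .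
  define u where "u = hess_block_inv i *\<^sub>v p"
  have uc: "u \<in> carrier_vec (n i)" unfolding u_def by (rule hess_block_inv_props(1)[OF c i pc])
  have "trajectory \<epsilon> g x0 (Suc t) i - xs i = trajectory \<epsilon> g x0 t i - xs i - \<epsilon> \<cdot>\<^sub>v u"
    unfolding \<tau>(2) p_def[symmetric] u_def[symmetric]
    using block_stateD[OF bs i, of t] block_stateD[OF xs i] uc by (intro eq_vecI) auto
  then show "\<exists>\<tau>. (\<forall>j k. t - (2 * T + 1) \<le> \<tau> j k \<and> \<tau> j k \<le> t) \<and>
     trajectory \<epsilon> g x0 (Suc t) i - xs i = trajectory \<epsilon> g x0 t i - xs i - \<epsilon> \<cdot>\<^sub>v
       (hess_block_inv i *\<^sub>v backproject i (\<lambda>j. predict j (\<lambda>k. trajectory \<epsilon> g x0 (\<tau> j k) k - xs k)))"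
    using \<tau>(1) unfolding u_def p by blast
qed

text \<open>The deterministic core: the threshold on \<open>\<epsilon>\<close> is found before the initial state and the loss
  pattern are given.\<close>

lemma rwls_exponential_convergence:
  assumes rad: "radially_unbounded N n J" and min: "unique_minimizer N n J xs"
  shows "\<exists>\<epsilon>b>0. \<forall>\<epsilon>. 0 < \<epsilon> \<and> \<epsilon> < \<epsilon>b \<longrightarrow>
    (\<forall>x0\<in>state_space N n. \<forall>g. persistent T g \<longrightarrow> (\<exists>C>0. \<exists>\<rho>. 0 < \<rho> \<and> \<rho> < 1 \<and>
       (\<forall>t. state_norm N (\<lambda>i. trajectory \<epsilon> g x0 t i - xs i) \<le> C * \<rho> ^ t)))"
proof -
  obtain c where c: "coercive_const c"
    using hess_form_coercive[OF rad min] unfolding coercive_const_def by blast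
  obtain \<epsilon>b where \<epsilon>b: "0 < \<epsilon>b" "\<And>\<epsilon> e. 0 < \<epsilon> \<Longrightarrow> \<epsilon> < \<epsilon>b \<Longrightarrow> delayed_descent (2 * T + 1) \<epsilon> e \<Longrightarrow>
    (\<exists>C>0. \<exists>\<rho>. 0 < \<rho> \<and> \<rho> < 1 \<and> (\<forall>t. state_norm N (e t) \<le> C * \<rho> ^ t))"
    using delayed_descent_decay[OF c, of "2 * T + 1"] by blast
  show ?thesis
  proof (rule exI[of _ \<epsilon>b], intro conjI allI impI ballI)
    fix \<epsilon> x0 g assume *: "0 < \<epsilon> \<and> \<epsilon> < \<epsilon>b" "x0 \<in> state_space N n" "persistent T g"
    show "\<exists>C>0. \<exists>\<rho>. 0 < \<rho> \<and> \<rho> < 1 \<and>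
       (\<forall>t. state_norm N (\<lambda>i. trajectory \<epsilon> g x0 t i - xs i) \<le> C * \<rho> ^ t)"
      using \<epsilon>b(2)[OF _ _ error_recursion[OF c min state_space_block[OF *(2)] *(3)]] *(1) by blast
  qed (rule \<epsilon>b(1))
qed

end

section \<open>Almost sure convergence\<close>

text \<open>There are countably many windows, so their null sets may be discarded simultaneously.\<close>

lemma (in prob_space) AE_event_in_every_window:
  fixes X :: "nat \<Rightarrow> 'a \<Rightarrow> nat"
  assumes X: "\<And>s. X s \<in> M \<rightarrow>\<^sub>M count_space {0, 1}"
    and null: "\<And>t. prob {\<omega> \<in> space M. \<forall>s\<in>{t..t+T}. X s \<omega> = 0} = 0"
  shows "AE \<omega> in M. \<forall>t. \<exists>s\<in>{t..t+T}. X s \<omega> = 1"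
proof -
  have "AE \<omega> in M. \<exists>s\<in>{t..t+T}. X s \<omega> = 1" for t
  proof -
    have "{\<omega> \<in> space M. \<forall>s\<in>{t..t+T}. X s \<omega> = 0} \<in> events"
    proof (rule sets.sets_Collect_finite_All')
      fix s
      have "X s -` {0} \<inter> space M \<in> events" by (rule measurable_sets[OF X]) simp
      moreover have "X s -` {0} \<inter> space M = {\<omega> \<in> space M. X s \<omega> = 0}" by auto
      ultimately show "{\<omega> \<in> space M. X s \<omega> = 0} \<in> events" by simp
    qed auto
    then have "AE \<omega> in M. \<not> (\<forall>s\<in>{t..t+T}. X s \<omega> = 0)"
      using null[of t] by (intro AE_I'[of "{\<omega> \<in> space M. \<forall>s\<in>{t..t+T}. X s \<omega> = 0}"])
        (auto simp: null_sets_def emeasure_eq_measure)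
    then show ?thesis
    proof (rule AE_mp, intro AE_I2 impI)
      fix \<omega> assume "\<omega> \<in> space M" and "\<not> (\<forall>s\<in>{t..t+T}. X s \<omega> = 0)"
      then obtain s where s: "s \<in> {t..t+T}" "X s \<omega> \<noteq> 0" by blast
      have "X s \<omega> \<in> {0, 1}" using measurable_space[OF X \<open>\<omega> \<in> space M\<close>] by simp
      then show "\<exists>s\<in>{t..t+T}. X s \<omega> = 1" using s by blast
    qed
  qed
  then show ?thesis by (simp add: AE_all_countable)
qed

theorem lemma10:
  fixes N :: nat
    and G :: "nat pair_pre_digraph"
    and n m :: "nat \<Rightarrow> nat"
    and A :: "nat \<Rightarrow> nat \<Rightarrow> real mat"
    and W :: "nat \<Rightarrow> real mat"
    and y :: "nat \<Rightarrow> real Matrix.vec"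
    and xs :: state
    and M :: "'w measure"
    and \<gamma> :: "nat \<Rightarrow> nat \<Rightarrow> nat \<Rightarrow> 'w \<Rightarrow> nat"
  assumes "wls_problem N G n m A W y"
    and "strictly_convex N n (wls_problem.J N G m A W y)"
    and "radially_unbounded N n (wls_problem.J N G m A W y)"
    and "unique_minimizer N n (wls_problem.J N G m A W y) xs"
    and "prob_space M"
    and "\<And>i j t. i \<in> {1..N} \<Longrightarrow> j \<in> closed_neighbors G i \<Longrightarrow>
           \<gamma> i j t \<in> M \<rightarrow>\<^sub>M count_space {0, 1}"
    and "\<And>i t \<omega>. i \<in> {1..N} \<Longrightarrow> \<omega> \<in> space M \<Longrightarrow> \<gamma> i i t \<omega> = 1"
    and "\<exists>T. \<forall>t. \<forall>i\<in>{1..N}. \<forall>j\<in>neighbors G i.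
           measure M {\<omega> \<in> space M. \<forall>s\<in>{t..t+T}. \<gamma> i j s \<omega> = 0} = 0"
  shows "\<exists>\<epsilon>_bar>0. \<forall>\<epsilon>. 0 < \<epsilon> \<and> \<epsilon> < \<epsilon>_bar \<longrightarrow>
           (\<forall>x0\<in>state_space N n. AE \<omega> in M. \<exists>C>0. \<exists>\<rho>. 0 < \<rho> \<and> \<rho> < 1 \<and>
              (\<forall>t. state_norm N (\<lambda>i. wls_problem.trajectory G n m A W y \<epsilon>
                                        (\<lambda>i j t. \<gamma> i j t \<omega>) x0 t i - xs i) \<le> C * \<rho> ^ t))"
proof -
  interpret wls_problem N G n m A W y by (rule assms(1))
  interpret prob_space M by (rule assms(5))
  obtain T where T: "\<And>t i j. i \<in> {1..N} \<Longrightarrow> j \<in> neighbors G i \<Longrightarrow>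
      prob {\<omega> \<in> space M. \<forall>s\<in>{t..t+T}. \<gamma> i j s \<omega> = 0} = 0"
    using assms(8) by blast
  have fin: "finite (neighbors G i)" if "i \<in> {1..N}" for i
    using finite_cn[OF that] by (simp add: cn_insert)
  have "AE \<omega> in M. \<forall>i\<in>{1..N}. \<forall>j\<in>neighbors G i. \<forall>t. \<exists>s\<in>{t..t+T}. \<gamma> i j s \<omega> = 1"
    by (intro AE_finite_allI fin AE_event_in_every_window assms(6) T neighbor_cn) auto
  then have pers: "AE \<omega> in M. persistent T (\<lambda>i j t. \<gamma> i j t \<omega>)"
    unfolding persistent_def by (rule AE_mp) (intro AE_I2 impI, blast)
  from rwls_exponential_convergence[OF assms(3,4), of T]
  obtain \<epsilon>b where \<epsilon>b: "0 < \<epsilon>b \<and> (\<forall>\<epsilon>. 0 < \<epsilon> \<and> \<epsilon> < \<epsilon>b \<longrightarrow>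
    (\<forall>x0\<in>state_space N n. \<forall>g. persistent T g \<longrightarrow> (\<exists>C>0. \<exists>\<rho>. 0 < \<rho> \<and> \<rho> < 1 \<and>
       (\<forall>t. state_norm N (\<lambda>i. trajectory \<epsilon> g x0 t i - xs i) \<le> C * \<rho> ^ t))))" ..
  show ?thesis
  proof (rule exI[of _ \<epsilon>b], intro conjI allI impI ballI)
    show "0 < \<epsilon>b" using \<epsilon>b by (rule conjunct1)
    fix \<epsilon> x0 assume *: "0 < \<epsilon> \<and> \<epsilon> < \<epsilon>b" "x0 \<in> state_space N n"
    note conv = \<epsilon>b[THEN conjunct2, rule_format, OF *]
    show "AE \<omega> in M. \<exists>C>0. \<exists>\<rho>. 0 < \<rho> \<and> \<rho> < 1 \<and>
       (\<forall>t. state_norm N (\<lambda>i. trajectory \<epsilon> (\<lambda>i j t. \<gamma> i j t \<omega>) x0 t i - xs i) \<le> C * \<rho> ^ t)"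
      using pers by (rule AE_mp) (intro AE_I2 impI conv)
  qed
qed

end
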